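(* Let $f:(M,h)\to(N,g)$ be a holomorphic map between two Hermitian manifolds. Then the following inequality of real $(1,1)$-forms holds on the projective bundle $\mathbb P(T_M)\to M$: $$\sqrt{-1}\,\partial\bar\partial\,\mathscr Y\ \geq\ \left(\sqrt{-1}\,\partial\bar\partial\log\mathscr H^{-1}\right)\cdot\mathscr Y-\frac{\sqrt{-1}\,R_{i\bar jk\bar\ell}\,f^i_\alpha\overline{f^j_\beta}\,f^k_\mu\overline{f^\ell_\nu}\,W^\mu\overline{W^\nu}\,dz^\alpha\wedge d\bar z^\beta}{\mathscr H}.$$ In particular, if $f:M\to\mathbb C$ is a holomorphic function (with $\mathbb C$ carrying its flat metric), then $$\sqrt{-1}\,\partial\bar\partial\,\mathscr Y\ \geq\ \left(\sqrt{-1}\,\partial\bar\partial\log\mathscr H^{-1}\right)\cdot\mathscr Y .$$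
   Context: $\{z^\alpha\}_{\alpha=1}^m$ and $\{\eta^i\}_{i=1}^n$ are local holomorphic coordinates on $M$ (near $p$) and $N$ (near $f(p)$); $h=(h_{\alpha\bar\beta})$, $g=(g_{i\bar j})$; $f^i_\alpha=\partial f^i/\partial z^\alpha$. Repeated indices are summed. $\mathbb P(T_M)\to M$ is the bundle whose fiber over $p$ is the set of complex lines in $T_pM=T^{1,0}_pM$; $(W^1,\dots,W^m)$ are the holomorphic fiber coordinates on $T_pM$ with respect to the frame $\partial/\partial z^\alpha$ (homogeneous coordinates on the fibers of $\mathbb P(T_M)$). Set $\mathscr H=\sum h_{\gamma\bar\delta}W^\gamma\overline{W^\delta}$ and $$\mathscr Y=g_{i\bar j}f^i_\alpha\overline{f^j_\beta}\,\frac{W^\alpha\overline{W^\beta}}{\sum h_{\gamma\bar\delta}W^\gamma\overline{W^\delta}},$$ a well-defined function on $\mathbb P(T_M)$. The form $\partial\bar\partial\log\mathscr H^{-1}$ is well defined on $\mathbb P(T_M)$ (computed with any local holomorphic choice of homogeneous coordinates), and the forms $dz^\alpha$ are pulled back to $\mathbb P(T_M)$. $R_{i\bar jk\bar\ell}$ is the curvature of the Chern connection of $(N,g)$: $R_{k\bar\ell i\bar j}=-\frac{\partial^2g_{i\bar j}}{\partial\eta^k\partial\bar\eta^\ell}+g^{p\bar q}\frac{\partial g_{i\bar q}}{\partial\eta^k}\frac{\partial g_{p\bar j}}{\partial\bar\eta^\ell}$, evaluated at $f(p)$. For real $(1,1)$-forms, $A\ge B$ means that $A-B$ is semi-positive.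 *)

theory Defs
  imports "HOL-Analysis.Analysis"
begin

section \<open>Wirtinger derivatives, smooth and holomorphic maps\<close>

definition dir_deriv :: "(complex ^ 'k::finite \<Rightarrow> complex) \<Rightarrow> complex ^ 'k \<Rightarrow> complex ^ 'k \<Rightarrow> complex" where
  "dir_deriv u v x = vector_derivative (\<lambda>t::real. u (x + t *\<^sub>R v)) (at 0)"

text \<open>The operators d/dx^A and d/d(conjugate of x^A). They only look at the complex line through
  the point in the direction of the coordinate A.\<close>

definition wd :: "'k::finite \<Rightarrow> (complex ^ 'k \<Rightarrow> complex) \<Rightarrow> complex ^ 'k \<Rightarrow> complex" where
  "wd A u x = (dir_deriv u (axis A 1) x - \<i> * dir_deriv u (axis A \<i>) x) / 2"

definition wdbar :: "'k::finite \<Rightarrow> (complex ^ 'k \<Rightarrow> complex) \<Rightarrow> complex ^ 'k \<Rightarrow> complex" where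
  "wdbar A u x = (dir_deriv u (axis A 1) x + \<i> * dir_deriv u (axis A \<i>) x) / 2"

primrec Ck_on :: "nat \<Rightarrow> 'a::real_normed_vector set \<Rightarrow> ('a \<Rightarrow> 'b::real_normed_vector) \<Rightarrow> bool" where
  "Ck_on 0 S u \<longleftrightarrow> continuous_on S u"
| "Ck_on (Suc k) S u \<longleftrightarrow> (\<forall>x\<in>S. u differentiable (at x)) \<and>
     (\<forall>v. Ck_on k S (\<lambda>x. frechet_derivative u (at x) v))"

text \<open>Only used on open sets of finite-dimensional spaces.\<close>

definition smooth_on :: "'a::real_normed_vector set \<Rightarrow> ('a \<Rightarrow> 'b::real_normed_vector) \<Rightarrow> bool" where
  "smooth_on S u \<longleftrightarrow> (\<forall>k. Ck_on k S u)"

definition holo_on :: "(complex ^ 'm::finite) set \<Rightarrow> (complex ^ 'm \<Rightarrow> complex ^ 'n::finite) \<Rightarrow> bool" where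
  "holo_on S F \<longleftrightarrow> (\<forall>z\<in>S. \<exists>F'. (F has_derivative F') (at z) \<and> (\<forall>k v. F' (k *s v) = k *s F' v))"

section \<open>Complex manifolds\<close>

text \<open>A chart is a domain together with a coordinate map; the values of the map outside of the
  domain are irrelevant.\<close>

type_synonym ('a, 'm) chart = "'a set \<times> ('a \<Rightarrow> complex ^ 'm)"

definition chart_inv :: "('a, 'm::finite) chart \<Rightarrow> complex ^ 'm \<Rightarrow> 'a" where
  "chart_inv c = inv_into (fst c) (snd c)"

definition complex_manifold :: "'a topology \<Rightarrow> ('a, 'm::finite) chart set \<Rightarrow> bool" where
  "complex_manifold X A \<longleftrightarrow>
     Hausdorff_space X \<and> second_countable X \<and> (\<Union>c\<in>A. fst c) = topspace X \<and>
     (\<forall>c\<in>A. openin X (fst c) \<and> open (snd c ` fst c) \<and>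
        homeomorphic_map (subtopology X (fst c)) (top_of_set (snd c ` fst c)) (snd c)) \<and>
     (\<forall>c\<in>A. \<forall>d\<in>A. holo_on (snd c ` (fst c \<inter> fst d)) (snd d \<circ> chart_inv c))"

definition holomorphic_map :: "'a topology \<Rightarrow> ('a, 'm::finite) chart set \<Rightarrow>
    'b topology \<Rightarrow> ('b, 'n::finite) chart set \<Rightarrow> ('a \<Rightarrow> 'b) \<Rightarrow> bool" where
  "holomorphic_map X A Y B f \<longleftrightarrow> continuous_map X Y f \<and>
     (\<forall>c\<in>A. \<forall>d\<in>B. holo_on (snd c ` (fst c \<inter> f -` fst d)) (snd d \<circ> f \<circ> chart_inv c))"

text \<open>The derivative of the i-th coordinate of f (in the chart d) with respect to the j-th
  coordinate of the chart c, at the point p.\<close>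

definition map_jac :: "('a, 'm::finite) chart \<Rightarrow> ('b, 'n::finite) chart \<Rightarrow> ('a \<Rightarrow> 'b) \<Rightarrow> 'a \<Rightarrow> complex ^ 'm ^ 'n" where
  "map_jac c d f p = (\<chi> i j. wd j (\<lambda>z. snd d (f (chart_inv c z)) $ i) (snd c p))"

section \<open>Holomorphic tangent vectors and Hermitian metrics\<close>

text \<open>A vector of type (1,0) at p is the family of its coordinate vectors with respect to all charts
  of the atlas around p, related by the Jacobians of the coordinate changes. The family is
  0 at all other charts, so that equality of vectors is equality of functions.\<close>

type_synonym ('a, 'm) tvec = "('a, 'm) chart \<Rightarrow> complex ^ 'm"

definition tangent_space :: "('a, 'm::finite) chart set \<Rightarrow> 'a \<Rightarrow> ('a, 'm) tvec set" where
  "tangent_space A p = {v.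
     (\<forall>c. \<not> (c \<in> A \<and> p \<in> fst c) \<longrightarrow> v c = 0) \<and>
     (\<forall>c\<in>A. \<forall>d\<in>A. p \<in> fst c \<inter> fst d \<longrightarrow> v d = map_jac c d id p *v v c)}"

definition tzero :: "('a, 'm::finite) tvec" where
  "tzero = (\<lambda>c. 0)"

definition tadd :: "('a, 'm::finite) tvec \<Rightarrow> ('a, 'm) tvec \<Rightarrow> ('a, 'm) tvec" where
  "tadd v w = (\<lambda>c. v c + w c)"

definition tscale :: "complex \<Rightarrow> ('a, 'm::finite) tvec \<Rightarrow> ('a, 'm) tvec" where
  "tscale k v = (\<lambda>c. k *s v c)"

definition coord_frame :: "('a, 'm::finite) chart set \<Rightarrow> ('a, 'm) chart \<Rightarrow> 'a \<Rightarrow> 'm \<Rightarrow> ('a, 'm) tvec" where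
  "coord_frame A c p \<alpha> =
     (\<lambda>d. if d \<in> A \<and> p \<in> fst d then map_jac c d id p *v axis \<alpha> 1 else 0)"

type_synonym ('a, 'm) metric = "'a \<Rightarrow> ('a, 'm) tvec \<Rightarrow> ('a, 'm) tvec \<Rightarrow> complex"

definition metric_coeff :: "('a, 'm::finite) chart set \<Rightarrow> ('a, 'm) metric \<Rightarrow> ('a, 'm) chart \<Rightarrow>
    'a \<Rightarrow> 'm \<Rightarrow> 'm \<Rightarrow> complex" where
  "metric_coeff A h c p \<alpha> \<beta> = h p (coord_frame A c p \<alpha>) (coord_frame A c p \<beta>)"

definition hermitian_metric :: "'a topology \<Rightarrow> ('a, 'm::finite) chart set \<Rightarrow> ('a, 'm) metric \<Rightarrow> bool" where
  "hermitian_metric X A h \<longleftrightarrow>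
     (\<forall>p\<in>topspace X. \<forall>u\<in>tangent_space A p. \<forall>v\<in>tangent_space A p.
        (\<forall>w\<in>tangent_space A p. h p (tadd u v) w = h p u w + h p v w) \<and>
        (\<forall>k. h p (tscale k u) v = k * h p u v) \<and>
        h p v u = cnj (h p u v) \<and>
        (v \<noteq> tzero \<longrightarrow> 0 < Re (h p v v))) \<and>
     (\<forall>c\<in>A. \<forall>\<alpha> \<beta>. smooth_on (snd c ` fst c) (\<lambda>z. metric_coeff A h c (chart_inv c z) \<alpha> \<beta>))"

definition hermitian_manifold :: "'a topology \<Rightarrow> ('a, 'm::finite) chart set \<Rightarrow> ('a, 'm) metric \<Rightarrow> bool" where
  "hermitian_manifold X A h \<longleftrightarrow> complex_manifold X A \<and> hermitian_metric X A h"

text \<open>The index pair (p, q) of the inverse metric is normalised by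
  sum over q of G i q * ginv p q = (1 if i = p, else 0).
  In R k l i j the indices k and i are of type (1,0), and l and j of type (0,1).\<close>

definition metric_inv :: "('b, 'n::finite) chart set \<Rightarrow> ('b, 'n) metric \<Rightarrow> ('b, 'n) chart \<Rightarrow>
    'b \<Rightarrow> 'n \<Rightarrow> 'n \<Rightarrow> complex" where
  "metric_inv B g d y p q = matrix_inv (\<chi> i j. metric_coeff B g d y i j) $ q $ p"

definition chern_curv :: "('b, 'n::finite) chart set \<Rightarrow> ('b, 'n) metric \<Rightarrow> ('b, 'n) chart \<Rightarrow>
    'b \<Rightarrow> 'n \<Rightarrow> 'n \<Rightarrow> 'n \<Rightarrow> 'n \<Rightarrow> complex" where
  "chern_curv B g d y k l i j =
     (let G = (\<lambda>i j \<eta>. metric_coeff B g d (chart_inv d \<eta>) i j) in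
        - wd k (wdbar l (G i j)) (snd d y)
        + (\<Sum>p\<in>UNIV. \<Sum>q\<in>UNIV. metric_inv B g d y p q * wd k (G i q) (snd d y) * wdbar l (G p j) (snd d y)))"

text \<open>The manifold of complex numbers with its flat metric.\<close>

definition complex_chart :: "(complex, 1) chart" where
  "complex_chart = (UNIV, \<lambda>z. \<chi> i. z)"

definition flat_metric :: "(complex, 1) metric" where
  "flat_metric p v w = v complex_chart $ 1 * cnj (w complex_chart $ 1)"

section \<open>The projectivised tangent bundle\<close>

type_synonym ('a, 'm) ppoint = "'a \<times> ('a, 'm) tvec set"

definition proj_tangent :: "'a topology \<Rightarrow> ('a, 'm::finite) chart set \<Rightarrow> ('a, 'm) ppoint set" where
  "proj_tangent X A =
     {(p, L). p \<in> topspace X \<and> (\<exists>v\<in>tangent_space A p. v \<noteq> tzero \<and> L = range (\<lambda>k. tscale k v))}"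

text \<open>A chart c of M and an index a give the coordinates z^alpha and w^b = W^b / W^a (b different
  from a) on the set of all lines over the domain of c on which W^a does not vanish. We record them
  as a vector indexed by a disjoint sum, whose component \<open>Inr a\<close> is constantly 1; the genuine
  coordinates are those in \<open>proj_coords a\<close>, and the Inr part is the homogeneous coordinate vector
  W normalised by W^a = 1.\<close>

definition proj_coords :: "'m::finite \<Rightarrow> ('m + 'm) set" where
  "proj_coords a = UNIV - {Inr a}"

definition proj_chart :: "'a topology \<Rightarrow> ('a, 'm::finite) chart set \<Rightarrow> ('a, 'm) chart \<Rightarrow> 'm \<Rightarrow>
    (('a, 'm) ppoint, 'm + 'm) chart" where
  "proj_chart X A c a =
     ({Q \<in> proj_tangent X A. fst Q \<in> fst c \<and> (\<exists>v\<in>snd Q. v c $ a \<noteq> 0)},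
      \<lambda>Q. \<chi> s. case s of
         Inl \<alpha> \<Rightarrow> snd c (fst Q) $ \<alpha>
       | Inr b \<Rightarrow> (THE v. v \<in> snd Q \<and> v c $ a = 1) c $ b)"

definition base_part :: "complex ^ ('m + 'm) \<Rightarrow> complex ^ 'm::finite" where
  "base_part x = (\<chi> \<alpha>. x $ Inl \<alpha>)"

definition fibre_part :: "complex ^ ('m + 'm) \<Rightarrow> complex ^ 'm::finite" where
  "fibre_part x = (\<chi> b. x $ Inr b)"

definition H_local :: "('a, 'm::finite) chart set \<Rightarrow> ('a, 'm) metric \<Rightarrow> ('a, 'm) chart \<Rightarrow>
    'a \<Rightarrow> complex ^ 'm \<Rightarrow> complex" where
  "H_local A h c p W = (\<Sum>\<gamma>\<in>UNIV. \<Sum>\<delta>\<in>UNIV. metric_coeff A h c p \<gamma> \<delta> * W $ \<gamma> * cnj (W $ \<delta>))"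

definition Y_local :: "('a, 'm::finite) chart set \<Rightarrow> ('a, 'm) metric \<Rightarrow>
    ('b, 'n::finite) chart set \<Rightarrow> ('b, 'n) metric \<Rightarrow> ('a \<Rightarrow> 'b) \<Rightarrow>
    ('a, 'm) chart \<Rightarrow> ('b, 'n) chart \<Rightarrow> 'a \<Rightarrow> complex ^ 'm \<Rightarrow> complex" where
  "Y_local A h B g f c d p W =
     (\<Sum>i\<in>UNIV. \<Sum>j\<in>UNIV. \<Sum>\<alpha>\<in>UNIV. \<Sum>\<beta>\<in>UNIV.
        metric_coeff B g d (f p) i j * map_jac c d f p $ i $ \<alpha> * cnj (map_jac c d f p $ j $ \<beta>)
        * (W $ \<alpha> * cnj (W $ \<beta>) / H_local A h c p W))"

text \<open>The function on the projectivised tangent bundle whose expression in all local coordinates, for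
  all representatives of the line, is \<open>Y_local\<close>.\<close>

definition Y_fun :: "('a, 'm::finite) chart set \<Rightarrow> ('a, 'm) metric \<Rightarrow>
    ('b, 'n::finite) chart set \<Rightarrow> ('b, 'n) metric \<Rightarrow> ('a \<Rightarrow> 'b) \<Rightarrow> ('a, 'm) ppoint \<Rightarrow> complex" where
  "Y_fun A h B g f Q = (THE y. \<forall>c\<in>A. \<forall>d\<in>B. \<forall>v\<in>snd Q.
      fst Q \<in> fst c \<and> f (fst Q) \<in> fst d \<and> v \<noteq> tzero \<longrightarrow> y = Y_local A h B g f c d (fst Q) (v c))"

section \<open>Real (1,1)-forms\<close>

text \<open>In coordinates x^s (s in I) the form \<open>\<i>\<close> * (sum over s, t in I of \<phi> s t dx^s wedge the
  conjugate of dx^t) at a point is represented by the coefficients \<phi>; only the indices in I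
  matter.\<close>

definition real_form :: "'k set \<Rightarrow> ('k \<Rightarrow> 'k \<Rightarrow> complex) \<Rightarrow> bool" where
  "real_form I \<phi> \<longleftrightarrow> (\<forall>s\<in>I. \<forall>t\<in>I. \<phi> t s = cnj (\<phi> s t))"

definition form_ge :: "'k set \<Rightarrow> ('k \<Rightarrow> 'k \<Rightarrow> complex) \<Rightarrow> ('k \<Rightarrow> 'k \<Rightarrow> complex) \<Rightarrow> bool" where
  "form_ge I \<phi> \<psi> \<longleftrightarrow> real_form I \<phi> \<and> real_form I \<psi> \<and>
     (\<forall>\<xi>. 0 \<le> Re (\<Sum>s\<in>I. \<Sum>t\<in>I. (\<phi> s t - \<psi> s t) * \<xi> s * cnj (\<xi> t)))"

definition ddbar :: "(complex ^ 'k::finite \<Rightarrow> complex) \<Rightarrow> complex ^ 'k \<Rightarrow> 'k \<Rightarrow> 'k \<Rightarrow> complex" where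
  "ddbar u x s t = wd s (wdbar t u) x"

definition ddbar_Y :: "'a topology \<Rightarrow> ('a, 'm::finite) chart set \<Rightarrow> ('a, 'm) metric \<Rightarrow>
    ('b, 'n::finite) chart set \<Rightarrow> ('b, 'n) metric \<Rightarrow> ('a \<Rightarrow> 'b) \<Rightarrow>
    ('a, 'm) chart \<Rightarrow> 'm \<Rightarrow> ('a, 'm) ppoint \<Rightarrow> ('m + 'm) \<Rightarrow> ('m + 'm) \<Rightarrow> complex" where
  "ddbar_Y X A h B g f c a Q =
     ddbar (Y_fun A h B g f \<circ> chart_inv (proj_chart X A c a)) (snd (proj_chart X A c a) Q)"

text \<open>Here the holomorphic choice of homogeneous coordinates is the one with W^a = 1.
  On positive reals the complex logarithm is the real one.\<close>

definition ddbar_log_Hinv :: "'a topology \<Rightarrow> ('a, 'm::finite) chart set \<Rightarrow> ('a, 'm) metric \<Rightarrow>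
    ('a, 'm) chart \<Rightarrow> 'm \<Rightarrow> ('a, 'm) ppoint \<Rightarrow> ('m + 'm) \<Rightarrow> ('m + 'm) \<Rightarrow> complex" where
  "ddbar_log_Hinv X A h c a Q =
     ddbar (\<lambda>x. Ln (inverse (H_local A h c (chart_inv c (base_part x)) (fibre_part x))))
       (snd (proj_chart X A c a) Q)"

text \<open>The curvature term has only components in the directions of the base. As the quotient by H is
  homogeneous of degree 0 in W, any W representing the line may be inserted.\<close>

definition curv_form :: "'a topology \<Rightarrow> ('a, 'm::finite) chart set \<Rightarrow> ('a, 'm) metric \<Rightarrow>
    ('b, 'n::finite) chart set \<Rightarrow> ('b, 'n) metric \<Rightarrow> ('a \<Rightarrow> 'b) \<Rightarrow>
    ('a, 'm) chart \<Rightarrow> ('b, 'n) chart \<Rightarrow> 'm \<Rightarrow> ('a, 'm) ppoint \<Rightarrow> ('m + 'm) \<Rightarrow> ('m + 'm) \<Rightarrow> complex" where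
  "curv_form X A h B g f c d a Q s t =
     (case (s, t) of
        (Inl \<alpha>, Inl \<beta>) \<Rightarrow>
          (let p = fst Q; W = fibre_part (snd (proj_chart X A c a) Q); F = map_jac c d f p in
             (\<Sum>i\<in>UNIV. \<Sum>j\<in>UNIV. \<Sum>k\<in>UNIV. \<Sum>l\<in>UNIV. \<Sum>\<mu>\<in>UNIV. \<Sum>\<nu>\<in>UNIV.
                chern_curv B g d (f p) i j k l * F $ i $ \<alpha> * cnj (F $ j $ \<beta>)
                * F $ k $ \<mu> * cnj (F $ l $ \<nu>) * W $ \<mu> * cnj (W $ \<nu>))
             / H_local A h c p W)
      | _ \<Rightarrow> 0)"

end

theory Submission
  imports Defs "HOL-Complex_Analysis.Cauchy_Integral_Formula"
begin

text \<open>
  In coordinates \<open>z\<close> on the source, \<open>W\<close> on the fibres and \<open>\<eta>\<close> on the target, the vector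
  \<open>V\<^sup>i = \<Sum>\<alpha>. f\<^sup>i\<^sub>\<alpha> W\<^sup>\<alpha>\<close> is a holomorphic section of the pull-back of the tangent bundle of the target,
  and the function \<open>Y\<close> is the quotient \<open>N / H\<close> of the two squared norms \<open>N = g(V, V)\<close> and
  \<open>H = h(W, W)\<close>. Write \<open>Z\<^sub>s\<close> for the covariant derivative of \<open>V\<close> in the direction \<open>s\<close>, taken with
  the Chern connection. Then \<open>\<partial>\<^sub>s N = g(Z\<^sub>s, V)\<close>, and the complex Hessian of \<open>N\<close> plus the curvature
  term \<open>R(s, t, V, V)\<close> equals the Gram matrix \<open>g(Z\<^sub>s, Z\<^sub>t)\<close>; in coordinates this is the completion of
  a square, done in the locale \<open>metric_jet\<close> and in \<open>gram_representation\<close>.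

  The Hessian of \<open>N / H\<close> contains the term \<open>- N H\<^sub>s\<^sub>t / H\<^sup>2\<close>, which is absorbed by the Hessian of
  \<open>log (1 / H)\<close> times \<open>N / H\<close>. What remains of the difference of the two sides of the inequality is
  \<open>g(Z\<^sub>s - p\<^sub>s V, Z\<^sub>t - p\<^sub>t V) / H\<close> with \<open>p\<^sub>s = H\<^sub>s / H\<close>: again a Gram matrix of a positive form, hence
  semi-positive. This is \<open>section_norm_quotient_inequality\<close>. As \<open>H\<close> is the squared norm of the
  tautological section \<open>W\<close> over the identity map, one computation of first and second derivatives,
  in the locale \<open>holomorphic_section_norm\<close>, serves both norms.

  Two analytic facts are behind these derivatives. A holomorphic map is only assumed to be complex
  differentiable, so its partial derivatives have to be shown to be holomorphic again
  (\<open>sep_holo_wd\<close>); and the Hessians are Hermitian because mixed derivatives of the smooth metric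
  coefficients commute (\<open>mixed_derivatives_commute\<close>).

  The operators d/dx and d/d(conjugate of x) look only at one complex line through a point.
  Therefore all derivatives are computed line by line. This also makes it harmless that a
  projective chart takes its values in the slice on which one homogeneous coordinate is 1: the
  derivatives in the directions of the slice agree with those of an extension to an open set.
\<close>

section \<open>Wirtinger calculus along a coordinate line\<close>

text \<open>A real-linear map on the complex numbers has the form \<open>p t + q cnj t\<close> with unique coefficients,
  which are the two Wirtinger derivatives. Recording both coefficients of a differential at once
  gives a calculus with the usual sum, product and chain rules.\<close>

definition has_wirtinger ::
    "(complex ^ 'k::finite \<Rightarrow> complex) \<Rightarrow> 'k \<Rightarrow> complex ^ 'k \<Rightarrow> complex \<Rightarrow> complex \<Rightarrow> bool" where
  "has_wirtinger u A x p q \<longleftrightarrow>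
     ((\<lambda>t. u (x + axis A t)) has_derivative (\<lambda>t. p * t + q * cnj t)) (at 0)"

lemma axis_zero [simp]: "axis A (0::complex) = 0"
  by (simp add: vec_eq_iff axis_def)

lemma axis_add: "axis A (s + t :: complex) = axis A s + axis A t"
  by (simp add: vec_eq_iff axis_def)

lemma axis_component: "axis A t $ k = (if k = A then t else 0)" for t :: complex
  by (auto simp: axis_def)

lemma scaleR_axis: "r *\<^sub>R axis A (c::complex) = axis A (r *\<^sub>R c)"
  by (simp add: vec_eq_iff axis_def)

lemma complex_vec_axis_sum: "v = (\<Sum>k\<in>UNIV. axis k (v $ k))" for v :: "complex ^ 'n::finite"
  by (simp add: vec_eq_iff axis_component)

lemma norm_axis_complex: "norm (axis A t :: complex ^ 'k::finite) = norm t"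
proof -
  have "(\<Sum>i\<in>UNIV. (norm ((axis A t :: complex ^ 'k) $ i))\<^sup>2) = (\<Sum>i\<in>UNIV. if i = A then (norm t)\<^sup>2 else 0)"
    by (rule sum.cong) (auto simp: axis_component)
  then show ?thesis by (simp add: norm_vec_def L2_set_def)
qed

lemma bounded_linear_axis: "bounded_linear (axis A :: complex \<Rightarrow> complex ^ 'k::finite)"
  by (rule bounded_linear_intro[of _ 1])
     (simp_all add: axis_add scaleR_axis norm_axis_complex)

lemma has_derivative_axis_line:
  "((\<lambda>t. x + axis A t) has_derivative (axis A :: complex \<Rightarrow> complex ^ 'k::finite)) (at t0)"
proof -
  have "((\<lambda>t. axis A t :: complex ^ 'k) has_derivative axis A) (at t0)"
    using bounded_linear.has_derivative[OF bounded_linear_axis has_derivative_ident] .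
  from has_derivative_add[OF has_derivative_const this] show ?thesis by simp
qed

lemma continuous_axis_line:
  "continuous_on T (\<lambda>t. x + axis A t :: complex ^ 'k::finite)"
  by (intro continuous_intros bounded_linear.continuous_on[OF bounded_linear_axis])

lemma eventually_axis_line:
  fixes U :: "(complex ^ 'k::finite) set"
  assumes "open U" "x \<in> U"
  shows "eventually (\<lambda>t. x + axis A t \<in> U) (nhds 0)"
proof -
  have "open ((\<lambda>t. x + axis A t) -` U)"
    by (rule open_vimage[OF assms(1) continuous_axis_line])
  then show ?thesis
    using assms(2) by (auto simp: eventually_nhds intro!: exI[of _ "(\<lambda>t. x + axis A t) -` U"])
qed

lemma has_wirtinger_imp_dir_deriv:
  assumes "has_wirtinger u A x p q"
  shows "dir_deriv u (axis A c) x = p * c + q * cnj c"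
proof -
  have l: "((\<lambda>r::real. r *\<^sub>R c) has_derivative (\<lambda>r. r *\<^sub>R c)) (at 0)"
    by (intro derivative_eq_intros) auto
  have "((\<lambda>r::real. u (x + axis A (r *\<^sub>R c))) has_derivative
          (\<lambda>r. p * (r *\<^sub>R c) + q * cnj (r *\<^sub>R c))) (at 0)"
    using has_derivative_compose[OF l, of "\<lambda>t. u (x + axis A t)" "\<lambda>t. p * t + q * cnj t"] assms
    unfolding has_wirtinger_def by simp
  then have "((\<lambda>r::real. u (x + r *\<^sub>R axis A c)) has_vector_derivative (p * c + q * cnj c)) (at 0)"
    unfolding has_vector_derivative_def scaleR_axis
    by (simp add: algebra_simps)
  then show ?thesis
    unfolding dir_deriv_def by (rule vector_derivative_at)
qed

lemma has_wirtinger_wd: "has_wirtinger u A x p q \<Longrightarrow> wd A u x = p"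
  and has_wirtinger_wdbar: "has_wirtinger u A x p q \<Longrightarrow> wdbar A u x = q"
  unfolding wd_def wdbar_def by (simp_all add: has_wirtinger_imp_dir_deriv field_simps)

lemma has_wirtinger_cong:
  assumes "has_wirtinger u A x p q" "eventually (\<lambda>t. u (x + axis A t) = v (x + axis A t)) (nhds 0)"
  shows "has_wirtinger v A x p q"
proof -
  have "u (x + axis A 0) = v (x + axis A 0)"
    using eventually_nhds_x_imp_x[OF assms(2)] .
  moreover have "eventually (\<lambda>t. u (x + axis A t) = v (x + axis A t)) (at 0)"
    using assms(2) by (simp add: eventually_at_filter eventually_mono)
  ultimately show ?thesis
    using assms(1) unfolding has_wirtinger_def
    by (auto intro: has_derivative_transform_eventually)
qed

lemma has_wirtinger_cong_open:
  assumes "has_wirtinger u A x p q" "open U" "x \<in> U" "\<And>y. y \<in> U \<Longrightarrow> u y = v y"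
  shows "has_wirtinger v A x p q"
  by (rule has_wirtinger_cong[OF assms(1)],
      rule eventually_mono[OF eventually_axis_line[OF assms(2,3)]], rule assms(4))

lemma has_wirtinger_const: "has_wirtinger (\<lambda>_. c) A x 0 0"
  unfolding has_wirtinger_def by simp

lemma has_wirtinger_add:
  "has_wirtinger u A x p q \<Longrightarrow> has_wirtinger v A x p' q' \<Longrightarrow>
   has_wirtinger (\<lambda>y. u y + v y) A x (p + p') (q + q')"
  unfolding has_wirtinger_def
  by (drule (1) has_derivative_add) (simp add: algebra_simps)

lemma has_wirtinger_mult:
  "has_wirtinger u A x p q \<Longrightarrow> has_wirtinger v A x p' q' \<Longrightarrow>
   has_wirtinger (\<lambda>y. u y * v y) A x (p * v x + u x * p') (q * v x + u x * q')"
  unfolding has_wirtinger_def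
  by (drule (1) has_derivative_mult) (simp add: algebra_simps)

lemma has_wirtinger_cnj:
  "has_wirtinger u A x p q \<Longrightarrow> has_wirtinger (\<lambda>y. cnj (u y)) A x (cnj q) (cnj p)"
  unfolding has_wirtinger_def
  by (drule has_derivative_cnj) (simp add: algebra_simps)

lemma has_wirtinger_sum:
  assumes "\<And>i. i \<in> I \<Longrightarrow> has_wirtinger (u i) A x (p i) (q i)"
  shows "has_wirtinger (\<lambda>y. \<Sum>i\<in>I. u i y) A x (\<Sum>i\<in>I. p i) (\<Sum>i\<in>I. q i)"
  using assms
  by (induction I rule: infinite_finite_induct)
     (auto simp: has_wirtinger_const intro!: has_wirtinger_add)

lemma has_wirtinger_outer:
  assumes "has_wirtinger u A x p q" "(F has_field_derivative F') (at (u x))"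
  shows "has_wirtinger (\<lambda>y. F (u y)) A x (F' * p) (F' * q)"
proof -
  have "(F has_derivative (*) F') (at (u (x + axis A 0)))"
    using assms(2) by (simp add: has_field_derivative_def)
  from has_derivative_compose[OF assms(1)[unfolded has_wirtinger_def] this]
  show ?thesis unfolding has_wirtinger_def by (simp add: algebra_simps)
qed

text \<open>The two coefficients on each coordinate line determine the whole real differential, because
  the coordinate lines span the space.\<close>

lemma derivative_Wirtinger_decomposition:
  fixes G :: "complex ^ 'n::finite \<Rightarrow> complex"
  assumes "(G has_derivative G') (at y)"
  shows "has_wirtinger G k y (wd k G y) (wdbar k G y)"
    and "G' v = (\<Sum>k\<in>UNIV. wd k G y * v $ k + wdbar k G y * cnj (v $ k))"
proof -
  interpret G': bounded_linear G' using has_derivative_bounded_linear[OF assms] .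
  have lin: "G' (axis k t) =
      (G' (axis k 1) - \<i> * G' (axis k \<i>)) / 2 * t + (G' (axis k 1) + \<i> * G' (axis k \<i>)) / 2 * cnj t"
    for k t
  proof -
    have "axis k t = Re t *\<^sub>R axis k 1 + Im t *\<^sub>R axis k \<i>"
      unfolding scaleR_axis axis_add[symmetric] by (intro arg_cong[where f = "axis k"]) (simp add: complex_eq_iff)
    then have "G' (axis k t) = Re t *\<^sub>R G' (axis k 1) + Im t *\<^sub>R G' (axis k \<i>)"
      by (simp only: G'.add G'.scaleR)
    moreover have "(a - \<i> * b) / 2 * t + (a + \<i> * b) / 2 * cnj t = Re t *\<^sub>R a + Im t *\<^sub>R b" for a b
      by (simp add: complex_eq_iff) (simp add: field_simps)
    ultimately show ?thesis by simp
  qed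
  have hw: "has_wirtinger G k y ((G' (axis k 1) - \<i> * G' (axis k \<i>)) / 2)
      ((G' (axis k 1) + \<i> * G' (axis k \<i>)) / 2)" for k
    unfolding has_wirtinger_def lin[symmetric]
    using has_derivative_compose[OF has_derivative_axis_line, of G G' y k 0] assms by simp
  show "has_wirtinger G k y (wd k G y) (wdbar k G y)"
    unfolding has_wirtinger_wd[OF hw[of k]] has_wirtinger_wdbar[OF hw[of k]] by (rule hw)
  have "G' v = G' (\<Sum>k\<in>UNIV. axis k (v $ k))"
    by (rule arg_cong[where f = G'], rule complex_vec_axis_sum)
  also have "\<dots> = (\<Sum>k\<in>UNIV. G' (axis k (v $ k)))"
    by (rule G'.sum)
  also have "\<dots> = (\<Sum>k\<in>UNIV. wd k G y * v $ k + wdbar k G y * cnj (v $ k))"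
    unfolding has_wirtinger_wd[OF hw] has_wirtinger_wdbar[OF hw] by (intro sum.cong refl lin)
  finally show "G' v = (\<Sum>k\<in>UNIV. wd k G y * v $ k + wdbar k G y * cnj (v $ k))" .
qed

text \<open>The outer function is differentiated in all variables together, the inner ones along one line, on
  which they are holomorphic. This is the situation of a metric coefficient along a holomorphic map.\<close>

lemma has_wirtinger_compose:
  fixes G :: "complex ^ 'n::finite \<Rightarrow> complex" and F :: "complex ^ 'k::finite \<Rightarrow> complex ^ 'n"
  assumes F: "\<And>k. has_wirtinger (\<lambda>y. F y $ k) A x (P k) 0"
    and G: "G differentiable (at (F x))"
  shows "has_wirtinger (\<lambda>y. G (F y)) A x
     (\<Sum>k\<in>UNIV. wd k G (F x) * P k) (\<Sum>k\<in>UNIV. wdbar k G (F x) * cnj (P k))"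
proof -
  obtain G' where G': "(G has_derivative G') (at (F x))"
    using G unfolding differentiable_def by blast
  have expand: "v = (\<Sum>k\<in>UNIV. axis k (v $ k))" for v :: "complex ^ 'n"
    by (rule complex_vec_axis_sum)
  have l: "(\<Sum>k\<in>UNIV. axis k (P k * t)) = (\<chi> k. P k * t)" for t
    by (simp add: vec_eq_iff axis_component)
  have "((\<lambda>t. \<Sum>k\<in>UNIV. axis k (F (x + axis A t) $ k)) has_derivative
      (\<lambda>t. \<Sum>k\<in>UNIV. axis k (P k * t))) (at 0)"
    using F unfolding has_wirtinger_def
    by (intro has_derivative_sum bounded_linear.has_derivative[OF bounded_linear_axis]) simp
  then have "((\<lambda>t. F (x + axis A t)) has_derivative (\<lambda>t. \<chi> k. P k * t)) (at 0)"
    by (simp only: expand[symmetric] l)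
  from has_derivative_compose[OF this, of G G'] G'
  have "((\<lambda>t. G (F (x + axis A t))) has_derivative (\<lambda>t. G' (\<chi> k. P k * t))) (at 0)"
    by simp
  moreover have "G' (\<chi> k. P k * t) = (\<Sum>k\<in>UNIV. wd k G (F x) * P k) * t +
      (\<Sum>k\<in>UNIV. wdbar k G (F x) * cnj (P k)) * cnj t" for t
    unfolding derivative_Wirtinger_decomposition(2)[OF G'] sum.distrib sum_distrib_right
    by (simp add: mult.assoc)
  ultimately show ?thesis unfolding has_wirtinger_def by simp
qed

section \<open>Separately holomorphic functions\<close>

text \<open>Continuity together with holomorphy on the coordinate lines, the hypotheses of Osgood's lemma. The
  class is chosen because it is closed under partial derivatives by an argument in one variable, and
  is still enough for all chain rules below.\<close>

definition sep_holo :: "(complex ^ 'k::finite) set \<Rightarrow> (complex ^ 'k \<Rightarrow> complex) \<Rightarrow> bool" where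
  "sep_holo S u \<longleftrightarrow> continuous_on S u \<and>
     (\<forall>x\<in>S. \<forall>A. (\<lambda>t. u (x + axis A t)) field_differentiable (at 0))"

lemma sep_holo_has_wirtinger:
  assumes "sep_holo S u" "x \<in> S"
  shows "has_wirtinger u A x (wd A u x) 0"
proof -
  obtain d where "((\<lambda>t. u (x + axis A t)) has_field_derivative d) (at 0)"
    using assms unfolding sep_holo_def field_differentiable_def by blast
  then have "has_wirtinger u A x d 0"
    unfolding has_wirtinger_def has_field_derivative_def by simp
  then show ?thesis using has_wirtinger_wd[of u A x d 0] by simp
qed

lemma has_wirtinger_holo_iff:
  "has_wirtinger u A x p 0 \<longleftrightarrow> ((\<lambda>t. u (x + axis A t)) has_field_derivative p) (at 0)"
  unfolding has_wirtinger_def has_field_derivative_def by simp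

lemma sep_holoI:
  assumes "continuous_on S u" "\<And>x A. x \<in> S \<Longrightarrow> has_wirtinger u A x (P A x) 0"
  shows "sep_holo S u"
  using assms unfolding sep_holo_def has_wirtinger_holo_iff field_differentiable_def by blast

lemma sep_holo_continuous: "sep_holo S u \<Longrightarrow> continuous_on S u"
  by (simp add: sep_holo_def)

lemma sep_holo_sum:
  assumes "\<And>i. i \<in> I \<Longrightarrow> sep_holo S (u i)"
  shows "sep_holo S (\<lambda>y. \<Sum>i\<in>I. u i y)"
proof (rule sep_holoI)
  show "continuous_on S (\<lambda>y. \<Sum>i\<in>I. u i y)"
    by (intro continuous_on_sum sep_holo_continuous assms)
next
  fix x A assume "x \<in> S"
  then show "has_wirtinger (\<lambda>y. \<Sum>i\<in>I. u i y) A x (\<Sum>i\<in>I. wd A (u i) x) 0"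
    using has_wirtinger_sum[of I u A x "\<lambda>i. wd A (u i) x" "\<lambda>_. 0",
      OF sep_holo_has_wirtinger[OF assms]] by simp
qed

lemma sep_holo_mult:
  assumes "sep_holo S u" "sep_holo S v"
  shows "sep_holo S (\<lambda>y. u y * v y)"
proof (rule sep_holoI)
  show "continuous_on S (\<lambda>y. u y * v y)"
    using assms by (intro continuous_on_mult sep_holo_continuous)
next
  fix x A assume "x \<in> S"
  with assms show "has_wirtinger (\<lambda>y. u y * v y) A x (wd A u x * v x + u x * wd A v x) 0"
    using has_wirtinger_mult[of u A x "wd A u x" 0 v "wd A v x" 0]
    by (simp add: sep_holo_has_wirtinger)
qed

lemma has_wirtinger_component: "has_wirtinger (\<lambda>x. x $ k) A x (if k = A then 1 else 0) 0"
  unfolding has_wirtinger_holo_iff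
  by (auto simp: axis_component intro!: derivative_eq_intros)

lemma sep_holo_component: "sep_holo S (\<lambda>x. x $ k)"
  by (rule sep_holoI[OF _ has_wirtinger_component]) (intro continuous_intros)

lemma holo_on_has_wirtinger:
  assumes "holo_on S F" "z \<in> S"
  shows "has_wirtinger (\<lambda>z. F z $ i) A z (wd A (\<lambda>z. F z $ i) z) 0"
proof -
  obtain F' where F': "(F has_derivative F') (at z)" "\<And>k v. F' (k *s v) = k *s F' v"
    using assms unfolding holo_on_def by blast
  have der: "((\<lambda>t. F (z + axis A t) $ i) has_derivative (\<lambda>t. F' (axis A t) $ i)) (at 0)"
    using has_derivative_compose[OF has_derivative_axis_line, of F F' z A 0] F'(1)
    by (intro bounded_linear.has_derivative[OF bounded_linear_vec_nth]) simp
  have lin: "F' (axis A t) $ i = F' (axis A 1) $ i * t" for t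
  proof -
    have "axis A t = t *s axis A 1" by (simp add: vec_eq_iff axis_component)
    from trans[OF arg_cong[where f = F', OF this] F'(2)]
    have "F' (axis A t) = t *s F' (axis A 1)" .
    then show ?thesis by simp
  qed
  have "(\<lambda>t. F' (axis A t) $ i) = (\<lambda>t. F' (axis A 1) $ i * t + 0 * cnj t)"
    by (rule ext, subst lin, simp)
  with der have "has_wirtinger (\<lambda>z. F z $ i) A z (F' (axis A 1) $ i) 0"
    unfolding has_wirtinger_def by (simp only:)
  from this has_wirtinger_wd[OF this] show ?thesis by simp
qed

lemma holo_on_sep_holo:
  assumes "holo_on S F"
  shows "sep_holo S (\<lambda>z. F z $ i)"
proof (rule sep_holoI)
  have "continuous_on S F"
    using assms unfolding holo_on_def
    by (meson continuous_at_imp_continuous_on has_derivative_continuous)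
  then show "continuous_on S (\<lambda>z. F z $ i)" by (intro continuous_intros)
qed (rule holo_on_has_wirtinger[OF assms])

text \<open>Holomorphy at the centre of each line gives holomorphy at every point of a line, since a point of
  the line is the centre of the same line, shifted.\<close>

lemma sep_holo_line:
  assumes S: "open S" and u: "sep_holo S u" and T: "\<And>t. t \<in> T \<Longrightarrow> x + axis A t \<in> S" and t: "t \<in> T"
  shows "((\<lambda>t. u (x + axis A t)) has_field_derivative wd A u (x + axis A t)) (at t)"
proof -
  have "((\<lambda>s. u ((x + axis A t) + axis A s)) has_field_derivative wd A u (x + axis A t)) (at 0)"
    using sep_holo_has_wirtinger[OF u T[OF t]] unfolding has_wirtinger_holo_iff .
  moreover have "(x + axis A t) + axis A s = x + axis A (s + t)" for s
    by (simp add: axis_add)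
  ultimately have "((\<lambda>s. u (x + axis A (s + t))) has_field_derivative wd A u (x + axis A t)) (at 0)"
    by (simp only:)
  from DERIV_shift[THEN iffD2, OF this] show ?thesis by simp
qed

text \<open>Taylor's theorem to first order. The second derivative on the disc of radius \<open>r\<close> is bounded by
  Cauchy's inequality on discs of radius \<open>r\<close>, all of which lie in the disc of radius \<open>3 r\<close>.\<close>

lemma holomorphic_quadratic_remainder:
  assumes f: "f holomorphic_on ball 0 (3 * r)" and r: "r > 0"
    and B: "\<And>t. t \<in> ball 0 (3 * r) \<Longrightarrow> norm (f t) \<le> B"
    and h: "norm h \<le> r"
  shows "norm (f h - f 0 - deriv f 0 * h) \<le> 2 * B / r ^ 2 * norm h ^ 2"
proof -
  let ?S = "cball (0::complex) r"
  have sub: "cball x r \<subseteq> ball 0 (3 * r)" if "x \<in> ?S" for x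
  proof
    fix y assume "y \<in> cball x r"
    then have "norm (y - x) \<le> r" by (simp add: dist_norm norm_minus_commute)
    moreover have "norm y \<le> norm (y - x) + norm x" using norm_triangle_ineq[of "y - x" x] by simp
    ultimately show "y \<in> ball 0 (3 * r)" using that r by simp
  qed
  have der: "((deriv ^^ i) f has_field_derivative (deriv ^^ Suc i) f x) (at x within ?S)"
    if "x \<in> ?S" for x i
  proof -
    have "(deriv ^^ i) f holomorphic_on ball 0 (3 * r)"
      using f by (intro holomorphic_higher_deriv) auto
    moreover have "x \<in> ball 0 (3 * r)" using that r by auto
    ultimately show ?thesis
      by (simp add: holomorphic_derivI has_field_derivative_at_within)
  qed
  have bd: "norm ((deriv ^^ Suc 1) f x) \<le> 2 * B / r ^ 2" if "x \<in> ?S" for x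
  proof -
    have "norm ((deriv ^^ 2) f x) \<le> fact 2 * B / r ^ 2"
    proof (rule Cauchy_inequality)
      show "f holomorphic_on ball x r"
        using f sub[OF that] by (meson ball_subset_cball holomorphic_on_subset order_trans)
      show "continuous_on (cball x r) f"
        using f sub[OF that] holomorphic_on_imp_continuous_on holomorphic_on_subset by blast
      show "norm (f y) \<le> B" if "norm (x - y) = r" for y
        using B sub[OF \<open>x \<in> ?S\<close>] that by (auto simp: dist_norm)
    qed (rule r)
    then show ?thesis by (simp add: numeral_2_eq_2)
  qed
  have "norm ((deriv ^^ 0) f h - (\<Sum>i\<le>1. (deriv ^^ i) f 0 * (h - 0) ^ i / fact i))
      \<le> 2 * B / r ^ 2 * norm (h - 0) ^ Suc 1 / fact 1"
    by (rule complex_Taylor[where S = ?S]) (use der bd h r in auto)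
  then show ?thesis by (simp add: algebra_simps numeral_2_eq_2)
qed

text \<open>The partial derivative is a locally uniform limit of difference quotients, which are continuous
  and holomorphic on lines. The rate of convergence is uniform because the quadratic remainder on a
  line is controlled by a bound of the function on a compact ball.\<close>

lemma sep_holo_wd:
  assumes S: "open S" and u: "sep_holo S u"
  shows "sep_holo S (wd A u)"
proof -
  have local: "\<exists>r>0. ball z r \<subseteq> S \<and> continuous_on (ball z r) (wd A u) \<and>
      (\<forall>B. (\<lambda>t. wd A u (z + axis B t)) field_differentiable (at 0))" if z: "z \<in> S" for z
  proof -
    obtain e where e: "e > 0" "cball z e \<subseteq> S"
      using S z open_contains_cball by blast
    \<comment> \<open>A point within r of z, moved by at most 3 r along a line, stays in the ball of radius 4 r.\<close>
    define r where "r = e / 4"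
    have r: "r > 0" "cball z (4 * r) \<subseteq> S" using e by (auto simp: r_def)
    have "compact (u ` cball z (4 * r))"
      using sep_holo_continuous[OF u] r(2)
      by (intro compact_continuous_image) (auto intro: continuous_on_subset)
    then obtain C where C: "\<And>x. x \<in> cball z (4 * r) \<Longrightarrow> norm (u x) \<le> C"
      using compact_imp_bounded bounded_iff by (metis imageI)
    have line: "w + axis A t \<in> cball z (4 * r)" if "w \<in> ball z r" "t \<in> ball 0 (3 * r)" for w t
    proof -
      have "norm (w + axis A t - z) \<le> norm (w - z) + norm (axis A t)"
        using norm_triangle_ineq[of "w - z" "axis A t"] by (simp add: algebra_simps)
      then show ?thesis using that by (simp add: norm_axis_complex dist_norm norm_minus_commute)
    qed
    define h where "h n = complex_of_real (r * inverse (real (Suc n)))" for n :: nat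
    have h: "norm (h n) \<le> r" "h n \<noteq> 0" for n
    proof -
      have "norm (h n) = r * inverse (real (Suc n))"
        unfolding h_def norm_of_real using r(1) by simp
      also have "\<dots> \<le> r * 1"
        using r(1) by (intro mult_left_mono) (simp_all add: field_simps)
      finally show "norm (h n) \<le> r" by simp
      show "h n \<noteq> 0" unfolding h_def of_real_eq_0_iff using r(1) by simp
    qed
    have hlim: "h \<longlonglongrightarrow> 0"
    proof -
      have "(\<lambda>n. r * inverse (real (Suc n))) \<longlonglongrightarrow> r * 0"
        by (intro tendsto_mult tendsto_const LIMSEQ_inverse_real_of_nat)
      from tendsto_of_real[OF this, where 'a = complex] show ?thesis
        unfolding h_def by simp
    qed
    define Q where "Q n w = (u (w + axis A (h n)) - u w) / h n" for n w
    have est: "dist (Q n w) (wd A u w) \<le> 2 * C / r ^ 2 * norm (h n)" if w: "w \<in> ball z r" for n w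
    proof -
      let ?f = "\<lambda>t. u (w + axis A t)"
      have d: "(?f has_field_derivative wd A u (w + axis A t)) (at t)" if "t \<in> ball 0 (3 * r)" for t
        using sep_holo_line[OF S u _ that] line[OF w] r(2) by blast
      have "norm (?f (h n) - ?f 0 - deriv ?f 0 * h n) \<le> 2 * C / r ^ 2 * norm (h n) ^ 2"
      proof (rule holomorphic_quadratic_remainder)
        show "?f holomorphic_on ball 0 (3 * r)"
          unfolding holomorphic_on_open[OF open_ball] using d by blast
        show "norm (?f t) \<le> C" if "t \<in> ball 0 (3 * r)" for t
          using C line[OF w that] by blast
      qed (use r h in auto)
      moreover have "deriv ?f 0 = wd A u w"
        using DERIV_imp_deriv[OF d[of 0]] r by simp
      ultimately have *: "norm (u (w + axis A (h n)) - u w - wd A u w * h n) \<le> 2 * C / r ^ 2 * norm (h n) ^ 2"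
        by simp
      have "Q n w - wd A u w = (u (w + axis A (h n)) - u w - wd A u w * h n) / h n"
        using h by (simp add: Q_def field_simps)
      then have "dist (Q n w) (wd A u w) = norm (u (w + axis A (h n)) - u w - wd A u w * h n) / norm (h n)"
        by (simp add: dist_norm norm_divide)
      also have "\<dots> \<le> 2 * C / r ^ 2 * norm (h n) ^ 2 / norm (h n)"
        by (rule divide_right_mono[OF *]) simp
      also have "\<dots> = 2 * C / r ^ 2 * norm (h n)"
        using h by (simp add: power2_eq_square)
      finally show ?thesis .
    qed
    have ul: "uniform_limit (ball z r) Q (wd A u) sequentially"
    proof (rule uniform_limitI)
      fix e' :: real assume "e' > 0"
      have "(\<lambda>n. 2 * C / r ^ 2 * norm (h n)) \<longlonglongrightarrow> 2 * C / r ^ 2 * norm (0::complex)"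
        by (intro tendsto_intros hlim)
      then have "\<forall>\<^sub>F n in sequentially. 2 * C / r ^ 2 * norm (h n) < e'"
        using \<open>e' > 0\<close> by (simp add: order_tendstoD(2))
      then show "\<forall>\<^sub>F n in sequentially. \<forall>w\<in>ball z r. dist (Q n w) (wd A u w) < e'"
        by eventually_elim (meson est le_less_trans)
    qed
    have maps: "w + axis A (h n) \<in> S" "w \<in> S" if "w \<in> ball z r" for w n
      using line[OF that, of "h n"] line[OF that, of 0] h[of n] r by auto
    have cQ: "continuous_on (ball z r) (Q n)" for n
      unfolding Q_def
    proof (intro continuous_intros)
      show "continuous_on (ball z r) (\<lambda>w. u (w + axis A (h n)))"
        by (rule continuous_on_compose2[OF sep_holo_continuous[OF u]])
           (use maps in \<open>auto intro!: continuous_intros\<close>)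
      show "continuous_on (ball z r) u"
        by (rule continuous_on_subset[OF sep_holo_continuous[OF u]]) (use maps in auto)
    qed (use h in blast)
    have "continuous_on (ball z r) (wd A u)"
      by (rule uniform_limit_theorem[OF _ ul]) (use cQ in auto)
    moreover have "(\<lambda>t. wd A u (z + axis B t)) field_differentiable (at 0)" for B
    proof -
      have zt: "z + axis B t \<in> ball z r" if "t \<in> ball 0 r" for t
        using that by (simp add: dist_norm norm_axis_complex)
      have "(\<lambda>t. wd A u (z + axis B t)) holomorphic_on ball 0 r"
      proof (rule holomorphic_uniform_sequence[where f = "\<lambda>n t. Q n (z + axis B t)"])
        show "(\<lambda>t. Q n (z + axis B t)) holomorphic_on ball 0 r" for n
        proof -
          have "(\<lambda>t. u ((z + axis A (h n)) + axis B t)) holomorphic_on ball 0 r"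
            unfolding holomorphic_on_open[OF open_ball]
          proof (intro ballI exI)
            fix t assume t: "t \<in> ball (0::complex) r"
            show "((\<lambda>t. u ((z + axis A (h n)) + axis B t)) has_field_derivative
                wd B u ((z + axis A (h n)) + axis B t)) (at t)"
              by (rule sep_holo_line[OF S u _ t]) (use maps(1)[OF zt] in \<open>simp add: add_ac\<close>)
          qed
          moreover have "(\<lambda>t. u (z + axis B t)) holomorphic_on ball 0 r"
            unfolding holomorphic_on_open[OF open_ball]
          proof (intro ballI exI)
            fix t assume t: "t \<in> ball (0::complex) r"
            show "((\<lambda>t. u (z + axis B t)) has_field_derivative wd B u (z + axis B t)) (at t)"
              by (rule sep_holo_line[OF S u _ t]) (use maps(2)[OF zt] in simp)
          qed
          ultimately show ?thesis
            unfolding Q_def using h by (intro holomorphic_intros) (simp_all add: add_ac)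
        qed
        show "\<exists>d>0. cball x d \<subseteq> ball 0 r \<and>
            uniform_limit (cball x d) (\<lambda>n t. Q n (z + axis B t)) (\<lambda>t. wd A u (z + axis B t)) sequentially"
          if "x \<in> ball 0 r" for x :: complex
        proof -
          have "\<exists>d>0. cball x d \<subseteq> ball 0 r"
            by (rule open_contains_cball_eq[OF open_ball, rule_format, THEN iffD1, OF that])
          then obtain d where d: "d > 0" "cball x d \<subseteq> ball 0 r" by blast
          have "uniform_limit (cball x d) (\<lambda>n t. Q n (z + axis B t)) (\<lambda>t. wd A u (z + axis B t)) sequentially"
            by (rule uniform_limit_compose'[OF ul]) (use d(2) zt in blast)
          with d show ?thesis by blast
        qed
      qed simp
      then show ?thesis
        using r(1) by (intro holomorphic_on_imp_differentiable_at[of _ "ball 0 r"]) auto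
    qed
    moreover have "ball z r \<subseteq> S" using maps by blast
    ultimately show ?thesis using r(1) by blast
  qed
  show ?thesis
    unfolding sep_holo_def
  proof (intro conjI ballI allI)
    show "continuous_on S (wd A u)"
    proof (rule continuous_at_imp_continuous_on, rule ballI)
      fix z assume "z \<in> S"
      from local[OF this] obtain r where "r > 0" "continuous_on (ball z r) (wd A u)" by blast
      then show "isCont (wd A u) z"
        by (simp add: continuous_on_interior)
    qed
    show "(\<lambda>t. wd A u (z + axis B t)) field_differentiable (at 0)" if "z \<in> S" for z B
      using local[OF that] by blast
  qed
qed

section \<open>Symmetry of second derivatives\<close>

text \<open>By the mean value inequality in the direction \<open>v\<close>, applied to the increment of \<open>u\<close> by \<open>h w\<close>, it is
  enough to know the derivative in the direction \<open>v\<close> up to an error which is small compared with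
  \<open>h\<close>; its differential \<open>A\<close> at \<open>x\<close> provides this.\<close>

lemma second_difference_estimate:
  fixes u :: "'a::real_normed_vector \<Rightarrow> 'b::real_normed_vector"
  assumes D: "open D" "x \<in> D" and u: "\<And>y. y \<in> D \<Longrightarrow> u differentiable (at y)"
    and A: "((\<lambda>y. frechet_derivative u (at y) v) has_derivative A) (at x)"
    and e: "e > 0"
  shows "\<exists>d>0. \<forall>h. 0 < h \<and> h < d \<longrightarrow>
    norm (u (x + h *\<^sub>R v + h *\<^sub>R w) - u (x + h *\<^sub>R v) - u (x + h *\<^sub>R w) + u x - h\<^sup>2 *\<^sub>R A w) \<le> e * h\<^sup>2"
proof -
  interpret A: bounded_linear A using has_derivative_bounded_linear[OF A] .
  define P where "P y = frechet_derivative u (at y) v" for y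
  define K where "K = norm v + norm w + 1"
  have K: "K > 0" unfolding K_def using norm_ge_zero[of v] norm_ge_zero[of w] by linarith
  define e' where "e' = e / (2 * K)"
  have e': "e' > 0" using e K by (simp add: e'_def)
  obtain d1 where d1: "d1 > 0"
    "\<And>y. norm (y - x) < d1 \<Longrightarrow> norm (P y - P x - A (y - x)) \<le> e' * norm (y - x)"
    using A e' unfolding has_derivative_at_alt P_def by blast
  obtain d2 where d2: "d2 > 0" "ball x d2 \<subseteq> D"
    using D open_contains_ball by blast
  define d where "d = min d1 d2 / K"
  have d: "d > 0" using d1 d2 K by (simp add: d_def)
  have "norm (u (x + h *\<^sub>R v + h *\<^sub>R w) - u (x + h *\<^sub>R v) - u (x + h *\<^sub>R w) + u x - h\<^sup>2 *\<^sub>R A w) \<le> e * h\<^sup>2"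
    if h: "0 < h" "h < d" for h
  proof -
    have hK: "h * K < min d1 d2" using h K by (simp add: d_def pos_less_divide_eq)
    have small: "norm (s *\<^sub>R v + t *\<^sub>R w) \<le> h * K" if "0 \<le> s" "s \<le> h" "0 \<le> t" "t \<le> h" for s t
    proof -
      have "norm (s *\<^sub>R v + t *\<^sub>R w) \<le> s * norm v + t * norm w"
        using norm_triangle_ineq[of "s *\<^sub>R v" "t *\<^sub>R w"] that by simp
      also have "\<dots> \<le> h * norm v + h * norm w"
        using that by (intro add_mono mult_right_mono) auto
      also have "\<dots> \<le> h * K" using h by (simp add: K_def algebra_simps)
      finally show ?thesis .
    qed
    have inD: "x + s *\<^sub>R v + t *\<^sub>R w \<in> D" if "0 \<le> s" "s \<le> h" "0 \<le> t" "t \<le> h" for s t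
    proof -
      have "dist x (x + s *\<^sub>R v + t *\<^sub>R w) = norm (s *\<^sub>R v + t *\<^sub>R w)"
        by (metis add.assoc add_diff_cancel_left' dist_commute dist_norm)
      then show ?thesis using small[OF that] hK d2(2) by (auto simp: subset_iff)
    qed
    \<comment> \<open>The increment of u by h w, corrected by its expected linear growth in s.\<close>
    define psi where "psi s = u (x + s *\<^sub>R v + h *\<^sub>R w) - u (x + s *\<^sub>R v) - (s * h) *\<^sub>R A w" for s
    define psi' where "psi' s = P (x + s *\<^sub>R v + h *\<^sub>R w) - P (x + s *\<^sub>R v) - h *\<^sub>R A w" for s
    have du: "((\<lambda>s. u (x + s *\<^sub>R v + y)) has_derivative (\<lambda>r. r *\<^sub>R P (x + s *\<^sub>R v + y))) (at s within {0..h})"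
      if "x + s *\<^sub>R v + y \<in> D" for s y
    proof -
      have "((\<lambda>s. x + s *\<^sub>R v + y) has_derivative (\<lambda>r. r *\<^sub>R v)) (at s within {0..h})"
        by (auto intro!: derivative_eq_intros)
      moreover have "(u has_derivative frechet_derivative u (at (x + s *\<^sub>R v + y))) (at (x + s *\<^sub>R v + y))"
        using u[OF that] frechet_derivative_works by blast
      ultimately have "((\<lambda>s. u (x + s *\<^sub>R v + y)) has_derivative
          (\<lambda>r. frechet_derivative u (at (x + s *\<^sub>R v + y)) (r *\<^sub>R v))) (at s within {0..h})"
        by (rule has_derivative_compose)
      then show ?thesis
        using linear_frechet_derivative[OF u[OF that]] by (simp add: P_def linear_scale)
    qed
    have "norm (psi h - psi 0) \<le> (2 * e' * (h * K)) * norm (h - 0)"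
    proof (rule differentiable_bound[of "{0..h}"])
      fix s assume s: "s \<in> {0..h}"
      have "((\<lambda>s. u (x + s *\<^sub>R v + h *\<^sub>R w)) has_derivative (\<lambda>r. r *\<^sub>R P (x + s *\<^sub>R v + h *\<^sub>R w))) (at s within {0..h})"
        by (rule du) (use inD[of s h] s h in auto)
      moreover have "((\<lambda>s. u (x + s *\<^sub>R v)) has_derivative (\<lambda>r. r *\<^sub>R P (x + s *\<^sub>R v))) (at s within {0..h})"
        using du[of s 0] inD[of s 0] s h by simp
      moreover have "((\<lambda>s. (s * h) *\<^sub>R A w) has_derivative (\<lambda>r. r *\<^sub>R (h *\<^sub>R A w))) (at s within {0..h})"
        by (auto intro!: derivative_eq_intros)
      ultimately show "(psi has_derivative (\<lambda>r. r *\<^sub>R psi' s)) (at s within {0..h})"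
        unfolding psi_def[abs_def] psi'_def scaleR_diff_right by (intro has_derivative_diff)
      have "norm (psi' s) \<le> 2 * e' * (h * K)"
      proof -
        have bd: "norm (P (x + s *\<^sub>R v + t *\<^sub>R w) - P x - A (s *\<^sub>R v + t *\<^sub>R w)) \<le> e' * (h * K)"
          if "0 \<le> t" "t \<le> h" for t
        proof -
          have sm: "norm (s *\<^sub>R v + t *\<^sub>R w) \<le> h * K" using small[of s t] s that by simp
          have "norm (P (x + (s *\<^sub>R v + t *\<^sub>R w)) - P x - A (s *\<^sub>R v + t *\<^sub>R w)) \<le> e' * norm (s *\<^sub>R v + t *\<^sub>R w)"
            using d1(2)[of "x + (s *\<^sub>R v + t *\<^sub>R w)"] sm hK by simp
          also have "\<dots> \<le> e' * (h * K)" using sm e' by (intro mult_left_mono) auto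
          finally show ?thesis by (simp add: add.assoc)
        qed
        have "psi' s = (P (x + s *\<^sub>R v + h *\<^sub>R w) - P x - A (s *\<^sub>R v + h *\<^sub>R w))
            - (P (x + s *\<^sub>R v + 0 *\<^sub>R w) - P x - A (s *\<^sub>R v + 0 *\<^sub>R w))"
          by (simp add: psi'_def A.add A.scaleR)
        also have "norm \<dots> \<le> e' * (h * K) + e' * (h * K)"
          by (rule norm_triangle_le_diff, rule add_mono) (rule bd; use h in simp)+
        finally show ?thesis by (simp only: mult_2 distrib_right)
      qed
      then show "onorm (\<lambda>r. r *\<^sub>R psi' s) \<le> 2 * e' * (h * K)"
        by (intro onorm_le) (metis abs_ge_zero mult.commute mult_left_mono norm_scaleR real_norm_def)
    qed (use h in auto)
    moreover have "psi h - psi 0 = u (x + h *\<^sub>R v + h *\<^sub>R w) - u (x + h *\<^sub>R v) - u (x + h *\<^sub>R w) + u x - h\<^sup>2 *\<^sub>R A w"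
      by (simp add: psi_def power2_eq_square)
    moreover have "(2 * e' * (h * K)) * norm (h - 0) = e * h\<^sup>2"
      using K h by (simp add: e'_def power2_eq_square)
    ultimately show ?thesis by simp
  qed
  then show ?thesis using d by blast
qed

text \<open>Both mixed derivatives are the limit of the same symmetric second difference, divided by the
  square of the step.\<close>

lemma mixed_derivatives_commute:
  fixes u :: "'a::real_normed_vector \<Rightarrow> 'b::real_normed_vector"
  assumes D: "open D" "x \<in> D" and u: "\<And>y. y \<in> D \<Longrightarrow> u differentiable (at y)"
    and A: "((\<lambda>y. frechet_derivative u (at y) v) has_derivative A) (at x)"
    and B: "((\<lambda>y. frechet_derivative u (at y) w) has_derivative B) (at x)"
  shows "A w = B v"
proof (rule ccontr)
  assume "A w \<noteq> B v"
  define e where "e = norm (A w - B v) / 3"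
  have e: "e > 0" using \<open>A w \<noteq> B v\<close> by (simp add: e_def)
  obtain d1 where d1: "d1 > 0" "\<And>h. 0 < h \<and> h < d1 \<Longrightarrow>
    norm (u (x + h *\<^sub>R v + h *\<^sub>R w) - u (x + h *\<^sub>R v) - u (x + h *\<^sub>R w) + u x - h\<^sup>2 *\<^sub>R A w) \<le> e * h\<^sup>2"
    using second_difference_estimate[OF D u A e, of w] by blast
  obtain d2 where d2: "d2 > 0" "\<And>h. 0 < h \<and> h < d2 \<Longrightarrow>
    norm (u (x + h *\<^sub>R w + h *\<^sub>R v) - u (x + h *\<^sub>R w) - u (x + h *\<^sub>R v) + u x - h\<^sup>2 *\<^sub>R B v) \<le> e * h\<^sup>2"
    using second_difference_estimate[OF D u B e, of v] by blast
  define h where "h = min d1 d2 / 2"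
  have h: "0 < h" "h < d1" "h < d2" using d1(1) d2(1) by (auto simp: h_def)
  define q where "q = u (x + h *\<^sub>R v + h *\<^sub>R w) - u (x + h *\<^sub>R v) - u (x + h *\<^sub>R w) + u x"
  have 1: "norm (q - h\<^sup>2 *\<^sub>R A w) \<le> e * h\<^sup>2" using d1(2)[of h] h by (simp add: q_def)
  have "u (x + h *\<^sub>R w + h *\<^sub>R v) - u (x + h *\<^sub>R w) - u (x + h *\<^sub>R v) + u x = q"
    by (simp add: q_def add_ac)
  then have 2: "norm (q - h\<^sup>2 *\<^sub>R B v) \<le> e * h\<^sup>2" using d2(2)[of h] h by simp
  have "h\<^sup>2 * norm (A w - B v) = norm ((q - h\<^sup>2 *\<^sub>R B v) - (q - h\<^sup>2 *\<^sub>R A w))"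
    by (simp add: scaleR_diff_right[symmetric])
  also have "\<dots> \<le> e * h\<^sup>2 + e * h\<^sup>2"
    by (rule norm_triangle_le_diff) (use 1 2 in simp)
  also have "\<dots> < h\<^sup>2 * (3 * e)" using e h by simp
  also have "\<dots> = h\<^sup>2 * norm (A w - B v)" by (simp add: e_def)
  finally show False by simp
qed

lemma dir_deriv_has_derivative:
  assumes "(f has_derivative f') (at x)"
  shows "dir_deriv f v x = f' v"
proof -
  have "((\<lambda>t::real. x + t *\<^sub>R v) has_derivative (\<lambda>t. t *\<^sub>R v)) (at 0)"
    by (auto intro!: derivative_eq_intros)
  then have "((\<lambda>t. f (x + t *\<^sub>R v)) has_derivative (\<lambda>t. f' (t *\<^sub>R v))) (at 0)"
    by (rule has_derivative_compose) (simp add: assms)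
  then have "((\<lambda>t. f (x + t *\<^sub>R v)) has_vector_derivative f' v) (at 0)"
    using linear_scale[OF has_derivative_linear[OF assms]] by (simp add: has_vector_derivative_def)
  then show ?thesis unfolding dir_deriv_def by (rule vector_derivative_at)
qed

lemma smooth_on_frechet_derivative:
  assumes "smooth_on D G" "y \<in> D"
  shows "G differentiable (at y)"
    and "(\<lambda>x. frechet_derivative G (at x) v) differentiable (at y)"
proof -
  have "Ck_on (Suc (Suc 0)) D G" using assms(1) unfolding smooth_on_def by blast
  then show "G differentiable (at y)" "(\<lambda>x. frechet_derivative G (at x) v) differentiable (at y)"
    using assms(2) by simp_all
qed

text \<open>Wirtinger derivatives are complex combinations of directional derivatives, so their symmetry is
  that of the real second derivatives.\<close>

lemma smooth_on_Wirtinger: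
  assumes D: "open D" and G: "smooth_on D G" and y: "y \<in> D"
  shows "wd k G differentiable (at y)" "wdbar k G differentiable (at y)"
    and "wd k (wdbar l G) y = wdbar l (wd k G) y"
proof -
  define P where "P v x = frechet_derivative G (at x) v" for v x
  define S where "S v = frechet_derivative (P v) (at y)" for v
  have P: "(P v has_derivative S v) (at y)" for v
    using smooth_on_frechet_derivative(2)[OF G y, of v] frechet_derivative_works
    unfolding P_def[abs_def] S_def by blast
  have sym: "S v w = S w v" for v w
    using mixed_derivatives_commute[OF D y smooth_on_frechet_derivative(1)[OF G]] P
    unfolding P_def[abs_def] by blast
  have dir: "dir_deriv G v x = P v x" if "x \<in> D" for v x
    using dir_deriv_has_derivative smooth_on_frechet_derivative(1)[OF G that] frechet_derivative_works
    unfolding P_def by blast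
  have w: "(wd k G has_derivative (\<lambda>v. (S (axis k 1) v - \<i> * S (axis k \<i>) v) / 2)) (at y)" for k
  proof (rule has_derivative_transform_within_open[OF _ D y])
    show "((\<lambda>x. (P (axis k 1) x - \<i> * P (axis k \<i>) x) / 2) has_derivative
        (\<lambda>v. (S (axis k 1) v - \<i> * S (axis k \<i>) v) / 2)) (at y)"
      using P by (auto intro!: derivative_eq_intros)
  qed (simp add: wd_def dir)
  have wb: "(wdbar k G has_derivative (\<lambda>v. (S (axis k 1) v + \<i> * S (axis k \<i>) v) / 2)) (at y)" for k
  proof (rule has_derivative_transform_within_open[OF _ D y])
    show "((\<lambda>x. (P (axis k 1) x + \<i> * P (axis k \<i>) x) / 2) has_derivative
        (\<lambda>v. (S (axis k 1) v + \<i> * S (axis k \<i>) v) / 2)) (at y)"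
      using P by (auto intro!: derivative_eq_intros)
  qed (simp add: wdbar_def dir)
  show "wd k G differentiable (at y)" "wdbar k G differentiable (at y)"
    using w wb unfolding differentiable_def by blast+
  show "wd k (wdbar l G) y = wdbar l (wd k G) y"
    unfolding wd_def[of k "wdbar l G"] wdbar_def[of l "wd k G"]
      dir_deriv_has_derivative[OF w] dir_deriv_has_derivative[OF wb]
    using sym[of "axis k 1"] sym[of "axis k \<i>"] by (simp add: field_simps)
qed

section \<open>Sesquilinear forms and completion of the square\<close>

definition sesq :: "('n::finite \<Rightarrow> 'n \<Rightarrow> complex) \<Rightarrow> ('n \<Rightarrow> complex) \<Rightarrow> ('n \<Rightarrow> complex) \<Rightarrow> complex" where
  "sesq G a b = (\<Sum>i\<in>UNIV. \<Sum>j\<in>UNIV. G i j * a i * cnj (b j))"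

lemma sesq_add_left: "sesq G (\<lambda>i. a i + a' i) b = sesq G a b + sesq G a' b"
  by (simp add: sesq_def algebra_simps sum.distrib)

lemma sesq_add_right: "sesq G a (\<lambda>i. b i + b' i) = sesq G a b + sesq G a b'"
  by (simp add: sesq_def algebra_simps sum.distrib)

lemma sesq_scale_left: "sesq G (\<lambda>i. c * a i) b = c * sesq G a b"
  by (simp add: sesq_def sum_distrib_left mult_ac)

lemma sesq_scale_right: "sesq G a (\<lambda>i. c * b i) = cnj c * sesq G a b"
  by (simp add: sesq_def sum_distrib_left mult_ac)

lemma sesq_diff_left: "sesq G (\<lambda>i. a i - a' i) b = sesq G a b - sesq G a' b"
  by (simp add: sesq_def algebra_simps sum_subtractf)

lemma sesq_diff_right: "sesq G a (\<lambda>i. b i - b' i) = sesq G a b - sesq G a b'"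
  by (simp add: sesq_def algebra_simps sum_subtractf)

lemma sesq_zero: "sesq G (\<lambda>i. 0) b = 0" "sesq G a (\<lambda>i. 0) = 0"
  by (simp_all add: sesq_def)

lemma sesq_sum_left: "sesq G (\<lambda>i. \<Sum>s\<in>I. a s i) b = (\<Sum>s\<in>I. sesq G (a s) b)"
  by (induction I rule: infinite_finite_induct) (simp_all add: sesq_zero sesq_add_left)

lemma sesq_sum_right: "sesq G a (\<lambda>i. \<Sum>s\<in>I. b s i) = (\<Sum>s\<in>I. sesq G a (b s))"
  by (induction I rule: infinite_finite_induct) (simp_all add: sesq_zero sesq_add_right)

lemma sesq_cnj:
  assumes "\<And>i j. cnj (G i j) = G j i"
  shows "cnj (sesq G a b) = sesq G b a"
proof -
  have "cnj (sesq G a b) = (\<Sum>i\<in>UNIV. \<Sum>j\<in>UNIV. G j i * b j * cnj (a i))"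
    by (simp add: sesq_def assms mult_ac)
  also have "\<dots> = sesq G b a"
    unfolding sesq_def by (rule sum.swap)
  finally show ?thesis .
qed

text \<open>A Gram matrix contracted with \<open>\<xi>\<close> is the norm of the combination of its vectors with coefficients
  \<open>\<xi>\<close>.\<close>

lemma sesq_gram_nonneg:
  assumes "\<And>a. 0 \<le> Re (sesq G a a)"
  shows "0 \<le> Re (\<Sum>s\<in>I. \<Sum>t\<in>I. sesq G (q s) (q t) * \<xi> s * cnj (\<xi> t))"
proof -
  have "(\<Sum>s\<in>I. \<Sum>t\<in>I. sesq G (q s) (q t) * \<xi> s * cnj (\<xi> t)) =
      sesq G (\<lambda>i. \<Sum>s\<in>I. \<xi> s * q s i) (\<lambda>i. \<Sum>t\<in>I. \<xi> t * q t i)"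
    unfolding sesq_sum_left sesq_sum_right sesq_scale_left sesq_scale_right
    by (intro sum.cong refl) (simp add: mult_ac)
  then show ?thesis using assms by simp
qed

lemma sum_move_inside:
  "(\<Sum>p\<in>P. \<Sum>k\<in>A. \<Sum>l\<in>B. \<Sum>i\<in>C. \<Sum>j\<in>D. f p k l i j) =
   (\<Sum>k\<in>A. \<Sum>l\<in>B. \<Sum>i\<in>C. \<Sum>j\<in>D. \<Sum>p\<in>P. f p k l i j)"
  by ((rule trans[OF sum.swap], rule sum.cong[OF refl])+) (rule refl)

text \<open>The values at one point of all that enters the Hessian of \<open>g(V, V)\<close>: the metric \<open>G\<close>, its
  derivatives \<open>dG k i j\<close> of type (1,0) in the direction \<open>k\<close>, its mixed second derivatives
  \<open>ddG k l i j\<close>, the inverse metric, and the vector \<open>v\<close>. Derivatives of type (0,1) are conjugates of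
  the \<open>dG\<close>. The completion of the square is pure algebra with these numbers.\<close>

locale metric_jet =
  fixes G :: "'n::finite \<Rightarrow> 'n \<Rightarrow> complex" and dG :: "'n \<Rightarrow> 'n \<Rightarrow> 'n \<Rightarrow> complex"
    and ddG :: "'n \<Rightarrow> 'n \<Rightarrow> 'n \<Rightarrow> 'n \<Rightarrow> complex" and Ginv :: "'n \<Rightarrow> 'n \<Rightarrow> complex" and v :: "'n \<Rightarrow> complex"
  assumes G_cnj: "cnj (G i j) = G j i"
    and Ginv: "(\<Sum>i\<in>UNIV. G i j * Ginv i q) = (if q = j then 1 else 0)"
begin

definition curv :: "'n \<Rightarrow> 'n \<Rightarrow> 'n \<Rightarrow> 'n \<Rightarrow> complex" where
  "curv k l i j = - ddG k l i j + (\<Sum>p\<in>UNIV. \<Sum>q\<in>UNIV. Ginv p q * dG k i q * cnj (dG l j p))"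

text \<open>The derivative of the metric in the direction \<open>a\<close>, contracted with \<open>v\<close> in its linear argument: a
  covector.\<close>

definition dG_contracted :: "('n \<Rightarrow> complex) \<Rightarrow> 'n \<Rightarrow> complex" where
  "dG_contracted a j = (\<Sum>i\<in>UNIV. \<Sum>k\<in>UNIV. dG k i j * a k * v i)"

text \<open>Raising the index of this covector gives the connection form of the Chern connection in the
  direction \<open>a\<close>, applied to \<open>v\<close>.\<close>

definition connection :: "('n \<Rightarrow> complex) \<Rightarrow> 'n \<Rightarrow> complex" where
  "connection a i = (\<Sum>q\<in>UNIV. Ginv i q * dG_contracted a q)"

definition ddG_contracted :: "('n \<Rightarrow> complex) \<Rightarrow> ('n \<Rightarrow> complex) \<Rightarrow> complex" where
  "ddG_contracted a b = (\<Sum>k\<in>UNIV. \<Sum>l\<in>UNIV. \<Sum>i\<in>UNIV. \<Sum>j\<in>UNIV. ddG k l i j * a k * cnj (b l) * v i * cnj (v j))"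

lemma sesq_connection_left: "sesq G (connection a) b = (\<Sum>j\<in>UNIV. dG_contracted a j * cnj (b j))"
proof -
  have "sesq G (connection a) b = (\<Sum>j\<in>UNIV. \<Sum>i\<in>UNIV. \<Sum>q\<in>UNIV. G i j * Ginv i q * (dG_contracted a q * cnj (b j)))"
    unfolding sesq_def connection_def
    by (subst sum.swap) (simp add: sum_distrib_left sum_distrib_right mult_ac)
  also have "\<dots> = (\<Sum>j\<in>UNIV. \<Sum>q\<in>UNIV. (\<Sum>i\<in>UNIV. G i j * Ginv i q) * (dG_contracted a q * cnj (b j)))"
    by (subst sum.swap) (simp add: sum_distrib_right)
  also have "\<dots> = (\<Sum>j\<in>UNIV. \<Sum>q\<in>UNIV. if q = j then dG_contracted a q * cnj (b j) else 0)"
    unfolding Ginv by (intro sum.cong refl) simp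
  finally show ?thesis by simp
qed

lemma sesq_connection_right: "sesq G b (connection a) = (\<Sum>j\<in>UNIV. b j * cnj (dG_contracted a j))"
proof -
  have "sesq G b (connection a) = cnj (sesq G (connection a) b)"
    by (simp add: sesq_cnj G_cnj)
  then show ?thesis by (simp add: sesq_connection_left mult_ac)
qed

text \<open>The part of the curvature that is quadratic in first derivatives is the inner product of two
  connection terms, because the inverse metric pairs the covectors \<open>dG_contracted a\<close> and \<open>dG_contracted b\<close>.\<close>

lemma curv_contract:
  "(\<Sum>k\<in>UNIV. \<Sum>l\<in>UNIV. \<Sum>i\<in>UNIV. \<Sum>j\<in>UNIV. curv k l i j * a k * cnj (b l) * v i * cnj (v j))
     = sesq G (connection a) (connection b) - ddG_contracted a b"
proof -
  have cnjT: "cnj (dG_contracted b p) = (\<Sum>l\<in>UNIV. \<Sum>j\<in>UNIV. cnj (dG l j p) * cnj (b l) * cnj (v j))" for p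
    unfolding dG_contracted_def cnj_sum by (subst sum.swap) simp
  have T': "dG_contracted a q = (\<Sum>k\<in>UNIV. \<Sum>i\<in>UNIV. dG k i q * a k * v i)" for q
    unfolding dG_contracted_def by (rule sum.swap)
  have "sesq G (connection a) (connection b) = (\<Sum>p\<in>UNIV. \<Sum>q\<in>UNIV. Ginv p q * dG_contracted a q * cnj (dG_contracted b p))"
    unfolding sesq_connection_right unfolding connection_def by (simp add: sum_distrib_right)
  also have "\<dots> = (\<Sum>p\<in>UNIV. \<Sum>q\<in>UNIV. \<Sum>k\<in>UNIV. \<Sum>l\<in>UNIV. \<Sum>i\<in>UNIV. \<Sum>j\<in>UNIV.
      Ginv p q * dG k i q * cnj (dG l j p) * (a k * cnj (b l) * v i * cnj (v j)))"
  proof (intro sum.cong refl)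
    fix p q
    have "dG_contracted a q * cnj (dG_contracted b p) = (\<Sum>k\<in>UNIV. \<Sum>l\<in>UNIV. (\<Sum>i\<in>UNIV. dG k i q * a k * v i) *
        (\<Sum>j\<in>UNIV. cnj (dG l j p) * cnj (b l) * cnj (v j)))"
      unfolding cnjT T' by (simp add: sum_product)
    also have "\<dots> = (\<Sum>k\<in>UNIV. \<Sum>l\<in>UNIV. \<Sum>i\<in>UNIV. \<Sum>j\<in>UNIV. (dG k i q * a k * v i) *
        (cnj (dG l j p) * cnj (b l) * cnj (v j)))"
      by (simp only: sum_product)
    finally show "Ginv p q * dG_contracted a q * cnj (dG_contracted b p) = (\<Sum>k\<in>UNIV. \<Sum>l\<in>UNIV. \<Sum>i\<in>UNIV. \<Sum>j\<in>UNIV.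
      Ginv p q * dG k i q * cnj (dG l j p) * (a k * cnj (b l) * v i * cnj (v j)))"
      by (simp add: mult.assoc sum_distrib_left) (simp add: mult_ac)
  qed
  also have "\<dots> = (\<Sum>k\<in>UNIV. \<Sum>l\<in>UNIV. \<Sum>i\<in>UNIV. \<Sum>j\<in>UNIV. \<Sum>p\<in>UNIV. \<Sum>q\<in>UNIV.
      Ginv p q * dG k i q * cnj (dG l j p) * (a k * cnj (b l) * v i * cnj (v j)))"
    by (rule trans[OF sum.cong[OF refl sum_move_inside] sum_move_inside])
  also have "\<dots> = (\<Sum>k\<in>UNIV. \<Sum>l\<in>UNIV. \<Sum>i\<in>UNIV. \<Sum>j\<in>UNIV.
      (curv k l i j + ddG k l i j) * a k * cnj (b l) * v i * cnj (v j))"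
    by (intro sum.cong refl) (simp add: curv_def sum_distrib_right mult.assoc)
  also have "\<dots> = (\<Sum>k\<in>UNIV. \<Sum>l\<in>UNIV. \<Sum>i\<in>UNIV. \<Sum>j\<in>UNIV. curv k l i j * a k * cnj (b l) * v i * cnj (v j)) + ddG_contracted a b"
    unfolding ddG_contracted_def by (simp add: sum.distrib distrib_right)
  finally show ?thesis by simp
qed

text \<open>Here \<open>\<delta>\<close> and \<open>\<epsilon>\<close> stand for the derivatives of the section in the directions \<open>a\<close> and \<open>b\<close>, so that the
  first bracket is the Hessian of the squared norm by the product rule. The second derivatives of the
  metric cancel, and the four remaining terms are those of a product of two sums.\<close>

lemma hessian_plus_curv:
  "(ddG_contracted a b + (\<Sum>i\<in>UNIV. \<delta> i * cnj (dG_contracted b i)) + (\<Sum>j\<in>UNIV. dG_contracted a j * cnj (\<epsilon> j)) + sesq G \<delta> \<epsilon>)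
     + (\<Sum>k\<in>UNIV. \<Sum>l\<in>UNIV. \<Sum>i\<in>UNIV. \<Sum>j\<in>UNIV. curv k l i j * a k * cnj (b l) * v i * cnj (v j))
   = sesq G (\<lambda>i. connection a i + \<delta> i) (\<lambda>i. connection b i + \<epsilon> i)"
  by (simp add: curv_contract sesq_add_left sesq_add_right sesq_connection_left[of a \<epsilon>]
      sesq_connection_right[of \<delta> b])

end

section \<open>Norms of holomorphic sections of a pulled back bundle\<close>

lemma wd_wdbar_cnj:
  assumes "open D" "y \<in> D" "\<And>z. z \<in> D \<Longrightarrow> cnj (u z) = w z" "has_wirtinger u A y p q"
  shows "wd A w y = cnj q" "wdbar A w y = cnj p"
proof -
  have "has_wirtinger w A y (cnj q) (cnj p)"
    using has_wirtinger_cong_open[OF has_wirtinger_cnj[OF assms(4)] assms(1,2)] assms(3) by blast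
  then show "wd A w y = cnj q" "wdbar A w y = cnj p"
    by (simp_all add: has_wirtinger_wd has_wirtinger_wdbar)
qed

lemma has_wirtinger_sum_ex:
  assumes "\<And>i. i \<in> I \<Longrightarrow> \<exists>q. has_wirtinger (u i) A x (p i) q"
  shows "\<exists>q. has_wirtinger (\<lambda>y. \<Sum>i\<in>I. u i y) A x (\<Sum>i\<in>I. p i) q"
proof -
  have "\<forall>i\<in>I. \<exists>q. has_wirtinger (u i) A x (p i) q" using assms by (rule ballI)
  from bchoice[OF this] obtain q where "\<forall>i\<in>I. has_wirtinger (u i) A x (p i) (q i)" ..
  then have "has_wirtinger (\<lambda>y. \<Sum>i\<in>I. u i y) A x (\<Sum>i\<in>I. p i) (\<Sum>i\<in>I. q i)"
    by (intro has_wirtinger_sum) (rule bspec)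
  then show ?thesis ..
qed

text \<open>\<open>F\<close> is a holomorphic map into the domain \<open>D\<close> of a metric \<open>G\<close>, and \<open>V\<close> is a holomorphic section of
  the tangent bundle of \<open>D\<close> along \<open>F\<close>. The first and second derivatives of its squared norm \<open>P\<close> are
  named \<open>Pd\<close>, \<open>Pdbar\<close> and \<open>Pdd\<close>.\<close>

locale holomorphic_section_norm =
  fixes U :: "(complex ^ 'k::finite) set" and D :: "(complex ^ 'n::finite) set"
    and G :: "'n \<Rightarrow> 'n \<Rightarrow> complex ^ 'n \<Rightarrow> complex"
    and F V :: "'n \<Rightarrow> complex ^ 'k \<Rightarrow> complex"
  assumes U: "open U" and D: "open D" and G_smooth: "smooth_on D (G i j)"
    and G_cnj: "y \<in> D \<Longrightarrow> cnj (G i j y) = G j i y"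
    and F: "sep_holo U (F i)" and V: "sep_holo U (V i)"
    and FD: "x \<in> U \<Longrightarrow> (\<chi> i. F i x) \<in> D"
begin

definition P :: "complex ^ 'k \<Rightarrow> complex" where
  "P x = (\<Sum>i\<in>UNIV. \<Sum>j\<in>UNIV. G i j (\<chi> i. F i x) * (V i x * cnj (V j x)))"

definition Pd :: "'k \<Rightarrow> complex ^ 'k \<Rightarrow> complex" where
  "Pd s x = (\<Sum>i\<in>UNIV. \<Sum>j\<in>UNIV.
     (\<Sum>k\<in>UNIV. wd k (G i j) (\<chi> i. F i x) * wd s (F k) x) * (V i x * cnj (V j x))
     + G i j (\<chi> i. F i x) * (wd s (V i) x * cnj (V j x)))"

definition Pdbar :: "'k \<Rightarrow> complex ^ 'k \<Rightarrow> complex" where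
  "Pdbar t x = (\<Sum>i\<in>UNIV. \<Sum>j\<in>UNIV.
     (\<Sum>l\<in>UNIV. wdbar l (G i j) (\<chi> i. F i x) * cnj (wd t (F l) x)) * (V i x * cnj (V j x))
     + G i j (\<chi> i. F i x) * (V i x * cnj (wd t (V j) x)))"

definition Pdd :: "'k \<Rightarrow> 'k \<Rightarrow> complex ^ 'k \<Rightarrow> complex" where
  "Pdd s t x = (\<Sum>i\<in>UNIV. \<Sum>j\<in>UNIV.
     ((\<Sum>l\<in>UNIV. (\<Sum>k\<in>UNIV. wd k (wdbar l (G i j)) (\<chi> i. F i x) * wd s (F k) x) * cnj (wd t (F l) x))
        * (V i x * cnj (V j x))
      + (\<Sum>l\<in>UNIV. wdbar l (G i j) (\<chi> i. F i x) * cnj (wd t (F l) x)) * (wd s (V i) x * cnj (V j x)))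
     + ((\<Sum>k\<in>UNIV. wd k (G i j) (\<chi> i. F i x) * wd s (F k) x) * (V i x * cnj (wd t (V j) x))
      + G i j (\<chi> i. F i x) * (wd s (V i) x * cnj (wd t (V j) x))))"

lemma has_wirtinger_pull_back:
  assumes "x \<in> U" "u differentiable (at (\<chi> i. F i x))"
  shows "has_wirtinger (\<lambda>x. u (\<chi> i. F i x)) s x
    (\<Sum>k\<in>UNIV. wd k u (\<chi> i. F i x) * wd s (F k) x) (\<Sum>k\<in>UNIV. wdbar k u (\<chi> i. F i x) * cnj (wd s (F k) x))"
  using assms sep_holo_has_wirtinger[OF F] by (intro has_wirtinger_compose) simp_all

lemma has_wirtinger_V: "x \<in> U \<Longrightarrow> has_wirtinger (V i) s x (wd s (V i) x) 0"
  by (rule sep_holo_has_wirtinger[OF V])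

lemma has_wirtinger_cnj_holo:
  assumes "sep_holo U u" "x \<in> U"
  shows "has_wirtinger (\<lambda>x. cnj (u x)) s x 0 (cnj (wd s u x))"
  using has_wirtinger_cnj[OF sep_holo_has_wirtinger[OF assms]] by simp

lemma has_wirtinger_P:
  assumes x: "x \<in> U"
  shows "has_wirtinger P s x (Pd s x) (Pdbar s x)"
proof -
  have "has_wirtinger (\<lambda>x. G i j (\<chi> i. F i x) * (V i x * cnj (V j x))) s x
      ((\<Sum>k\<in>UNIV. wd k (G i j) (\<chi> i. F i x) * wd s (F k) x) * (V i x * cnj (V j x))
       + G i j (\<chi> i. F i x) * (wd s (V i) x * cnj (V j x)))
      ((\<Sum>l\<in>UNIV. wdbar l (G i j) (\<chi> i. F i x) * cnj (wd s (F l) x)) * (V i x * cnj (V j x))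
       + G i j (\<chi> i. F i x) * (V i x * cnj (wd s (V j) x)))" for i j
    using has_wirtinger_mult[OF has_wirtinger_pull_back[OF x smooth_on_frechet_derivative(1)[OF G_smooth FD[OF x]]]
        has_wirtinger_mult[OF has_wirtinger_V[OF x] has_wirtinger_cnj_holo[OF V x]], of i j i j s]
    by simp
  then show ?thesis
    unfolding P_def[abs_def] Pd_def Pdbar_def by (intro has_wirtinger_sum)
qed

text \<open>The derivative of type (0,1) stays unnamed, as it does not occur in the complex Hessian. The one of
  type (1,0) passes over the conjugated factors, because the derivatives of \<open>F\<close> and \<open>V\<close> in the
  direction \<open>t\<close> are themselves holomorphic.\<close>

lemma has_wirtinger_Pdbar:
  assumes x: "x \<in> U"
  shows "\<exists>q. has_wirtinger (Pdbar t) s x (Pdd s t x) q"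
proof -
  have VV: "has_wirtinger (\<lambda>x. V i x * cnj (w x)) s x (wd s (V i) x * cnj (w x)) (V i x * cnj (wd s w x))"
    if "sep_holo U w" for i w
    using has_wirtinger_mult[OF has_wirtinger_V[OF x] has_wirtinger_cnj_holo[OF that x], of i s] by simp
  have FF: "has_wirtinger (\<lambda>x. \<Sum>l\<in>UNIV. wdbar l (G i j) (\<chi> i. F i x) * cnj (wd t (F l) x)) s x
      (\<Sum>l\<in>UNIV. (\<Sum>k\<in>UNIV. wd k (wdbar l (G i j)) (\<chi> i. F i x) * wd s (F k) x) * cnj (wd t (F l) x))
      (\<Sum>l\<in>UNIV. (\<Sum>k\<in>UNIV. wdbar k (wdbar l (G i j)) (\<chi> i. F i x) * cnj (wd s (F k) x)) * cnj (wd t (F l) x)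
        + wdbar l (G i j) (\<chi> i. F i x) * cnj (wd s (wd t (F l)) x))" for i j
  proof (rule has_wirtinger_sum)
    fix l
    show "has_wirtinger (\<lambda>x. wdbar l (G i j) (\<chi> i. F i x) * cnj (wd t (F l) x)) s x
      ((\<Sum>k\<in>UNIV. wd k (wdbar l (G i j)) (\<chi> i. F i x) * wd s (F k) x) * cnj (wd t (F l) x))
      ((\<Sum>k\<in>UNIV. wdbar k (wdbar l (G i j)) (\<chi> i. F i x) * cnj (wd s (F k) x)) * cnj (wd t (F l) x)
        + wdbar l (G i j) (\<chi> i. F i x) * cnj (wd s (wd t (F l)) x))"
      using has_wirtinger_mult[OF has_wirtinger_pull_back[OF x smooth_on_Wirtinger(2)[OF D G_smooth FD[OF x]]]
          has_wirtinger_cnj_holo[OF sep_holo_wd[OF U F] x], of l i j t l s]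
      by simp
  qed
  have "\<exists>q. has_wirtinger (\<lambda>x. (\<Sum>l\<in>UNIV. wdbar l (G i j) (\<chi> i. F i x) * cnj (wd t (F l) x)) * (V i x * cnj (V j x))
     + G i j (\<chi> i. F i x) * (V i x * cnj (wd t (V j) x))) s x
     (((\<Sum>l\<in>UNIV. (\<Sum>k\<in>UNIV. wd k (wdbar l (G i j)) (\<chi> i. F i x) * wd s (F k) x) * cnj (wd t (F l) x))
        * (V i x * cnj (V j x))
      + (\<Sum>l\<in>UNIV. wdbar l (G i j) (\<chi> i. F i x) * cnj (wd t (F l) x)) * (wd s (V i) x * cnj (V j x)))
     + ((\<Sum>k\<in>UNIV. wd k (G i j) (\<chi> i. F i x) * wd s (F k) x) * (V i x * cnj (wd t (V j) x))
      + G i j (\<chi> i. F i x) * (wd s (V i) x * cnj (wd t (V j) x)))) q" for i j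
    by (rule exI, rule has_wirtinger_add, rule has_wirtinger_mult[OF FF VV[OF V]],
        rule has_wirtinger_mult[OF has_wirtinger_pull_back[OF x smooth_on_frechet_derivative(1)[OF G_smooth FD[OF x]]]
          VV[OF sep_holo_wd[OF U V]]])
  then show ?thesis
    unfolding Pdbar_def[abs_def] Pdd_def by (intro has_wirtinger_sum_ex)
qed

text \<open>Conjugation exchanges the two types of derivatives and the two indices of the metric; for the
  second derivative the order of differentiation is exchanged as well.\<close>

lemma G_derivatives_cnj:
  assumes y: "y \<in> D"
  shows "wdbar k (G i j) y = cnj (wd k (G j i) y)"
    and "cnj (wd k (wdbar l (G i j)) y) = wd l (wdbar k (G j i)) y"
proof -
  have hw: "has_wirtinger u A z (wd A u z) (wdbar A u z)" if "u differentiable (at z)" for u :: "complex ^ 'n \<Rightarrow> complex" and A z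
    using that derivative_Wirtinger_decomposition(1) unfolding differentiable_def by blast
  have 1: "wdbar k (G i j) y = cnj (wd k (G j i) y)" if "y \<in> D" for k i j y
    by (rule wd_wdbar_cnj(2)[OF D that, where u = "G j i" and q = "wdbar k (G j i) y"])
       (use G_cnj hw smooth_on_frechet_derivative(1)[OF G_smooth that] in auto)
  show "wdbar k (G i j) y = cnj (wd k (G j i) y)" by (rule 1[OF y])
  have "wdbar k (wd l (G j i)) y = cnj (wd k (wdbar l (G i j)) y)"
    by (rule wd_wdbar_cnj(2)[OF D y, where u = "wdbar l (G i j)" and q = "wdbar k (wdbar l (G i j)) y"])
       (use 1 hw smooth_on_Wirtinger(2)[OF D G_smooth y] in auto)
  then show "cnj (wd k (wdbar l (G i j)) y) = wd l (wdbar k (G j i)) y"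
    using smooth_on_Wirtinger(3)[OF D G_smooth y] by metis
qed

lemma P_cnj: "x \<in> U \<Longrightarrow> cnj (P x) = P x"
  using sesq_cnj[of "\<lambda>i j. G i j (\<chi> i. F i x)" "\<lambda>i. V i x" "\<lambda>i. V i x"] G_cnj FD
  by (simp add: P_def sesq_def mult.assoc)

lemma Pd_cnj:
  assumes "x \<in> U"
  shows "cnj (Pd s x) = Pdbar s x"
proof -
  have "cnj (Pd s x) = (\<Sum>i\<in>UNIV. \<Sum>j\<in>UNIV.
     (\<Sum>l\<in>UNIV. wdbar l (G j i) (\<chi> i. F i x) * cnj (wd s (F l) x)) * (V j x * cnj (V i x))
     + G j i (\<chi> i. F i x) * (V j x * cnj (wd s (V i) x)))"
    unfolding Pd_def cnj_sum
    by (intro sum.cong refl)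
       (simp add: G_derivatives_cnj(1)[OF FD[OF assms]] G_cnj FD[OF assms] mult.commute)
  then show ?thesis
    unfolding Pdbar_def by (subst sum.swap) simp
qed

lemma Pdd_cnj:
  assumes "x \<in> U"
  shows "cnj (Pdd s t x) = Pdd t s x"
proof -
  note y = FD[OF assms]
  have dd: "cnj (\<Sum>l\<in>UNIV. (\<Sum>k\<in>UNIV. wd k (wdbar l (G i j)) (\<chi> i. F i x) * wd s (F k) x) * cnj (wd t (F l) x))
      = (\<Sum>l\<in>UNIV. (\<Sum>k\<in>UNIV. wd k (wdbar l (G j i)) (\<chi> i. F i x) * wd t (F k) x) * cnj (wd s (F l) x))"
    for i j
    by (simp add: sum_distrib_right G_derivatives_cnj(2)[OF y] mult.assoc, subst sum.swap)
       (simp add: mult_ac)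
  have d1: "cnj (\<Sum>k\<in>UNIV. wd k (G i j) (\<chi> i. F i x) * wd s (F k) x)
      = (\<Sum>l\<in>UNIV. wdbar l (G j i) (\<chi> i. F i x) * cnj (wd s (F l) x))" for i j s
    by (simp add: G_derivatives_cnj(1)[OF y])
  then have d2: "cnj (\<Sum>l\<in>UNIV. wdbar l (G i j) (\<chi> i. F i x) * cnj (wd s (F l) x))
      = (\<Sum>k\<in>UNIV. wd k (G j i) (\<chi> i. F i x) * wd s (F k) x)" for i j s
    by (metis complex_cnj_cnj)
  have "cnj (Pdd s t x) = (\<Sum>i\<in>UNIV. \<Sum>j\<in>UNIV.
     ((\<Sum>l\<in>UNIV. (\<Sum>k\<in>UNIV. wd k (wdbar l (G j i)) (\<chi> i. F i x) * wd t (F k) x) * cnj (wd s (F l) x))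
        * (V j x * cnj (V i x))
      + (\<Sum>l\<in>UNIV. wdbar l (G j i) (\<chi> i. F i x) * cnj (wd s (F l) x)) * (wd t (V j) x * cnj (V i x)))
     + ((\<Sum>k\<in>UNIV. wd k (G j i) (\<chi> i. F i x) * wd t (F k) x) * (V j x * cnj (wd s (V i) x))
      + G j i (\<chi> i. F i x) * (wd t (V j) x * cnj (wd s (V i) x))))"
    unfolding Pdd_def
    by (subst cnj_sum, intro sum.cong refl, subst cnj_sum, intro sum.cong refl)
       (simp only: complex_cnj_add complex_cnj_mult complex_cnj_cnj dd d1 d2 G_cnj[OF y],
        simp only: mult_ac add_ac)
  then show ?thesis
    unfolding Pdd_def by (subst sum.swap) simp
qed

end

context holomorphic_section_norm
begin

text \<open>The vectors \<open>Z s\<close> are the covariant derivatives of the section. Their Gram matrix and their products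
  with \<open>V\<close> are all that enters the inequality, hence the existential quantifier. The inverse metric
  may be any solution \<open>Ginv\<close> of its defining equations.\<close>

lemma gram_representation:
  assumes x: "x \<in> U"
    and Ginv: "\<And>j q. (\<Sum>i\<in>UNIV. G i j (\<chi> i. F i x) * Ginv i q) = (if q = j then 1 else 0)"
    and R: "\<And>k l i j. R k l i j = - wd k (wdbar l (G i j)) (\<chi> i. F i x)
      + (\<Sum>p\<in>UNIV. \<Sum>q\<in>UNIV. Ginv p q * wd k (G i q) (\<chi> i. F i x) * wdbar l (G p j) (\<chi> i. F i x))"
  shows "\<exists>Z. \<forall>s t. Pd s x = sesq (\<lambda>i j. G i j (\<chi> i. F i x)) (Z s) (\<lambda>i. V i x) \<and>
    Pdd s t x + (\<Sum>k\<in>UNIV. \<Sum>l\<in>UNIV. \<Sum>i\<in>UNIV. \<Sum>j\<in>UNIV.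
        R k l i j * wd s (F k) x * cnj (wd t (F l) x) * V i x * cnj (V j x))
      = sesq (\<lambda>i j. G i j (\<chi> i. F i x)) (Z s) (Z t)"
proof -
  note y = FD[OF x]
  interpret J: metric_jet "\<lambda>i j. G i j (\<chi> i. F i x)" "\<lambda>k i j. wd k (G i j) (\<chi> i. F i x)"
    "\<lambda>k l i j. wd k (wdbar l (G i j)) (\<chi> i. F i x)" Ginv "\<lambda>i. V i x"
    by unfold_locales (use G_cnj[OF y] Ginv in auto)
  have curv: "J.curv = R"
    by (intro ext) (simp add: J.curv_def R G_derivatives_cnj(1)[OF y])
  define Z where "Z s i = J.connection (\<lambda>k. wd s (F k) x) i + wd s (V i) x" for s i
  have T: "(\<Sum>i\<in>UNIV. \<Sum>j\<in>UNIV. (\<Sum>k\<in>UNIV. wd k (G i j) (\<chi> i. F i x) * a k) * (V i x * cnj (b j)))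
      = (\<Sum>j\<in>UNIV. J.dG_contracted a j * cnj (b j))" for a b
    unfolding J.dG_contracted_def by (subst sum.swap) (simp add: sum_distrib_left sum_distrib_right mult_ac)
  have Tbar: "(\<Sum>i\<in>UNIV. \<Sum>j\<in>UNIV. (\<Sum>k\<in>UNIV. wdbar k (G i j) (\<chi> i. F i x) * cnj (a k)) * (b i * cnj (V j x)))
      = (\<Sum>i\<in>UNIV. b i * cnj (J.dG_contracted a i))" for a b
    unfolding J.dG_contracted_def by (simp add: sum_distrib_left sum_distrib_right G_derivatives_cnj(1)[OF y] mult_ac)
  have K: "(\<Sum>i\<in>UNIV. \<Sum>j\<in>UNIV. (\<Sum>l\<in>UNIV. (\<Sum>k\<in>UNIV. wd k (wdbar l (G i j)) (\<chi> i. F i x) * a k) * cnj (b l))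
      * (V i x * cnj (V j x))) = J.ddG_contracted a b" for a b
  proof -
    have "J.ddG_contracted a b = (\<Sum>l\<in>UNIV. \<Sum>k\<in>UNIV. \<Sum>i\<in>UNIV. \<Sum>j\<in>UNIV.
        wd k (wdbar l (G i j)) (\<chi> i. F i x) * a k * cnj (b l) * V i x * cnj (V j x))"
      unfolding J.ddG_contracted_def by (rule sum.swap)
    also have "\<dots> = (\<Sum>l\<in>UNIV. \<Sum>i\<in>UNIV. \<Sum>j\<in>UNIV. \<Sum>k\<in>UNIV.
        wd k (wdbar l (G i j)) (\<chi> i. F i x) * a k * cnj (b l) * V i x * cnj (V j x))"
      by (rule sum.cong[OF refl], rule trans[OF sum.swap], rule sum.cong[OF refl], rule sum.swap)
    also have "\<dots> = (\<Sum>i\<in>UNIV. \<Sum>j\<in>UNIV. \<Sum>l\<in>UNIV. \<Sum>k\<in>UNIV.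
        wd k (wdbar l (G i j)) (\<chi> i. F i x) * a k * cnj (b l) * V i x * cnj (V j x))"
      by (rule trans[OF sum.swap], rule sum.cong[OF refl], rule sum.swap)
    also have "\<dots> = (\<Sum>i\<in>UNIV. \<Sum>j\<in>UNIV. (\<Sum>l\<in>UNIV. (\<Sum>k\<in>UNIV. wd k (wdbar l (G i j)) (\<chi> i. F i x) * a k) * cnj (b l))
      * (V i x * cnj (V j x)))"
      by (simp add: sum_distrib_right mult.assoc)
    finally show ?thesis by simp
  qed
  have S: "(\<Sum>i\<in>UNIV. \<Sum>j\<in>UNIV. G i j (\<chi> i. F i x) * (a i * cnj (b j))) = sesq (\<lambda>i j. G i j (\<chi> i. F i x)) a b" for a b
    by (simp add: sesq_def mult.assoc)
  have Pd_Z: "Pd s x = sesq (\<lambda>i j. G i j (\<chi> i. F i x)) (Z s) (\<lambda>i. V i x)" for s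
    unfolding Pd_def sum.distrib T S
    by (simp add: Z_def[abs_def] sesq_add_left J.sesq_connection_left)
  have "Pdd s t x = J.ddG_contracted (\<lambda>k. wd s (F k) x) (\<lambda>k. wd t (F k) x)
      + (\<Sum>i\<in>UNIV. wd s (V i) x * cnj (J.dG_contracted (\<lambda>k. wd t (F k) x) i))
      + (\<Sum>j\<in>UNIV. J.dG_contracted (\<lambda>k. wd s (F k) x) j * cnj (wd t (V j) x))
      + sesq (\<lambda>i j. G i j (\<chi> i. F i x)) (\<lambda>i. wd s (V i) x) (\<lambda>i. wd t (V i) x)" for s t
    unfolding Pdd_def sum.distrib T S K Tbar by (simp only: add.assoc)
  then have "Pdd s t x + (\<Sum>k\<in>UNIV. \<Sum>l\<in>UNIV. \<Sum>i\<in>UNIV. \<Sum>j\<in>UNIV.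
        R k l i j * wd s (F k) x * cnj (wd t (F l) x) * V i x * cnj (V j x))
      = sesq (\<lambda>i j. G i j (\<chi> i. F i x)) (Z s) (Z t)" for s t
    using J.hessian_plus_curv[of "\<lambda>k. wd s (F k) x" "\<lambda>k. wd t (F k) x" "\<lambda>i. wd s (V i) x" "\<lambda>i. wd t (V i) x"]
    unfolding curv Z_def[abs_def] by (simp only:)
  with Pd_Z show ?thesis by blast
qed

end

section \<open>The complex Hessian of a quotient and of a logarithm\<close>

lemma ddbar_eqI:
  assumes "open U" "x \<in> U" "\<And>y. y \<in> U \<Longrightarrow> has_wirtinger u t y (p y) (r y)" "has_wirtinger r s x a b"
  shows "ddbar u x s t = a"
proof -
  have "has_wirtinger (wdbar t u) s x a b"
    by (rule has_wirtinger_cong_open[OF assms(4,1,2)])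
       (rule has_wirtinger_wdbar[OF assms(3), symmetric])
  then show ?thesis unfolding ddbar_def by (rule has_wirtinger_wd)
qed

lemma has_wirtinger_inverse:
  assumes "has_wirtinger Q s x p q" "Q x \<noteq> 0"
  shows "has_wirtinger (\<lambda>y. inverse (Q y)) s x (- (inverse (Q x))\<^sup>2 * p) (- (inverse (Q x))\<^sup>2 * q)"
  using has_wirtinger_outer[OF assms(1) DERIV_inverse[OF assms(2)]]
  by (simp add: numeral_2_eq_2)

text \<open>The first derivatives are given on an open set, those of second order at \<open>x\<close> alone: a second
  derivative at \<open>x\<close> differentiates a first one along a line through \<open>x\<close>.\<close>

lemma ddbar_quotient:
  assumes U: "open U" "x \<in> U"
    and P: "\<And>y s. y \<in> U \<Longrightarrow> has_wirtinger P s y (Pd s y) (Pb s y)"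
    and PP: "\<exists>q. has_wirtinger (Pb t) s x Pdd q"
    and Q: "\<And>y s. y \<in> U \<Longrightarrow> has_wirtinger Q s y (Qd s y) (Qb s y)"
    and QQ: "\<exists>q. has_wirtinger (Qb t) s x Qdd q"
    and nz: "\<And>y. y \<in> U \<Longrightarrow> Q y \<noteq> 0"
  shows "ddbar (\<lambda>y. P y / Q y) x s t = Pdd / Q x - (Pb t x * Qd s x + Pd s x * Qb t x) / (Q x)\<^sup>2
     - P x * Qdd / (Q x)\<^sup>2 + 2 * P x * Qd s x * Qb t x / (Q x) ^ 3"
proof -
  obtain q q' where q: "has_wirtinger (Pb t) s x Pdd q" and q': "has_wirtinger (Qb t) s x Qdd q'"
    using PP QQ by blast
  note inv = has_wirtinger_inverse[OF Q nz]
  have "ddbar (\<lambda>y. P y * inverse (Q y)) x s t =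
     (Pdd * inverse (Q x) + Pb t x * (- (inverse (Q x))\<^sup>2 * Qd s x)) +
     (Pd s x * (((- 1) * (inverse (Q x) * inverse (Q x))) * Qb t x) +
      P x * (((- 1) * ((- (inverse (Q x))\<^sup>2 * Qd s x) * inverse (Q x) + inverse (Q x) * (- (inverse (Q x))\<^sup>2 * Qd s x))) * Qb t x
        + ((- 1) * (inverse (Q x) * inverse (Q x))) * Qdd))"
  proof (rule ddbar_eqI[OF U])
    fix y assume y: "y \<in> U"
    show "has_wirtinger (\<lambda>y. P y * inverse (Q y)) t y (Pd t y * inverse (Q y) + P y * (- (inverse (Q y))\<^sup>2 * Qd t y))
        (Pb t y * inverse (Q y) + P y * (((- 1) * (inverse (Q y) * inverse (Q y))) * Qb t y))"
      using has_wirtinger_mult[OF P[OF y] inv[OF y y], of t] by (simp add: power2_eq_square)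
  next
    \<comment> \<open>The derivative of 1 / Q, written as a product so that the product rule gives its derivative.\<close>
    have c: "has_wirtinger (\<lambda>y. (- 1) * (inverse (Q y) * inverse (Q y))) s x
        ((- 1) * ((- (inverse (Q x))\<^sup>2 * Qd s x) * inverse (Q x) + inverse (Q x) * (- (inverse (Q x))\<^sup>2 * Qd s x)))
        ((- 1) * ((- (inverse (Q x))\<^sup>2 * Qb s x) * inverse (Q x) + inverse (Q x) * (- (inverse (Q x))\<^sup>2 * Qb s x)))"
      using has_wirtinger_mult[OF has_wirtinger_const has_wirtinger_mult[OF inv[OF U(2) U(2)] inv[OF U(2) U(2)]], of "-1" s]
      by simp
    show "has_wirtinger (\<lambda>y. Pb t y * inverse (Q y) + P y * (((- 1) * (inverse (Q y) * inverse (Q y))) * Qb t y)) s x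
       ((Pdd * inverse (Q x) + Pb t x * (- (inverse (Q x))\<^sup>2 * Qd s x)) +
     (Pd s x * (((- 1) * (inverse (Q x) * inverse (Q x))) * Qb t x) +
      P x * (((- 1) * ((- (inverse (Q x))\<^sup>2 * Qd s x) * inverse (Q x) + inverse (Q x) * (- (inverse (Q x))\<^sup>2 * Qd s x))) * Qb t x
        + ((- 1) * (inverse (Q x) * inverse (Q x))) * Qdd)))
       ((q * inverse (Q x) + Pb t x * (- (inverse (Q x))\<^sup>2 * Qb s x)) +
     (Pb s x * (((- 1) * (inverse (Q x) * inverse (Q x))) * Qb t x) +
      P x * (((- 1) * ((- (inverse (Q x))\<^sup>2 * Qb s x) * inverse (Q x) + inverse (Q x) * (- (inverse (Q x))\<^sup>2 * Qb s x))) * Qb t x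
        + ((- 1) * (inverse (Q x) * inverse (Q x))) * q')))"
      by (intro has_wirtinger_add has_wirtinger_mult[OF q inv[OF U(2) U(2)]]
          has_wirtinger_mult[OF P[OF U(2)] has_wirtinger_mult[OF c q']])
  qed
  also have "\<dots> = Pdd / Q x - (Pb t x * Qd s x + Pd s x * Qb t x) / (Q x)\<^sup>2
     - P x * Qdd / (Q x)\<^sup>2 + 2 * P x * Qd s x * Qb t x / (Q x) ^ 3"
    using nz[OF U(2)] by (simp add: divide_simps power2_eq_square power3_eq_cube) (simp add: algebra_simps)
  finally show ?thesis by (simp add: divide_inverse)
qed

lemma ddbar_Ln_inverse:
  assumes U: "open U" "x \<in> U"
    and Q: "\<And>y s. y \<in> U \<Longrightarrow> has_wirtinger Q s y (Qd s y) (Qb s y)"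
    and QQ: "\<exists>q. has_wirtinger (Qb t) s x Qdd q"
    and pos: "\<And>y. y \<in> U \<Longrightarrow> inverse (Q y) \<notin> \<real>\<^sub>\<le>\<^sub>0"
  shows "ddbar (\<lambda>y. Ln (inverse (Q y))) x s t = Qd s x * Qb t x / (Q x)\<^sup>2 - Qdd / Q x"
proof -
  obtain q' where q': "has_wirtinger (Qb t) s x Qdd q'"
    using QQ by blast
  have nz: "Q y \<noteq> 0" if "y \<in> U" for y using pos[OF that] by auto
  note inv = has_wirtinger_inverse[OF Q nz]
  have "ddbar (\<lambda>y. Ln (inverse (Q y))) x s t =
     (- 1) * ((- (inverse (Q x))\<^sup>2 * Qd s x) * Qb t x + inverse (Q x) * Qdd)"
  proof (rule ddbar_eqI[OF U])
    fix y assume y: "y \<in> U"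
    show "has_wirtinger (\<lambda>y. Ln (inverse (Q y))) t y (inverse (inverse (Q y)) * (- (inverse (Q y))\<^sup>2 * Qd t y))
        ((- 1) * (inverse (Q y) * Qb t y))"
    proof -
      have "inverse (inverse (Q y)) * (- (inverse (Q y))\<^sup>2 * Qb t y) = (- 1) * (inverse (Q y) * Qb t y)"
        using nz[OF y] by (simp add: power2_eq_square)
      from has_wirtinger_outer[OF inv[OF y y] has_field_derivative_Ln[OF pos[OF y]], of t, unfolded this]
      show ?thesis .
    qed
  next
    show "has_wirtinger (\<lambda>y. (- 1) * (inverse (Q y) * Qb t y)) s x
     ((- 1) * ((- (inverse (Q x))\<^sup>2 * Qd s x) * Qb t x + inverse (Q x) * Qdd))
     ((- 1) * ((- (inverse (Q x))\<^sup>2 * Qb s x) * Qb t x + inverse (Q x) * q'))"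
      using has_wirtinger_mult[OF has_wirtinger_const has_wirtinger_mult[OF inv[OF U(2) U(2)] q'], of "-1"]
      by simp
  qed
  then show ?thesis
    using nz[OF U(2)] by (simp add: divide_simps power2_eq_square)
qed

text \<open>The difference of the two sides is the Gram matrix of the vectors \<open>q s = Z s - (H\<^sub>s / H) V\<close>, divided
  by the positive number \<open>H\<close>. Both sides are Hermitian, because the second
  derivatives of the two norms are and their first derivatives of the two types are conjugate.\<close>

lemma section_norm_quotient_inequality:
  fixes G :: "'n::finite \<Rightarrow> 'n \<Rightarrow> complex ^ 'n \<Rightarrow> complex" and h :: "'m::finite \<Rightarrow> 'm \<Rightarrow> complex ^ 'm \<Rightarrow> complex"
    and U :: "(complex ^ 'k::finite) set"
  assumes N: "holomorphic_section_norm U D G F V"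
    and H: "holomorphic_section_norm U E h F' W"
    and x: "x \<in> U"
    and pos: "\<And>y. y \<in> U \<Longrightarrow> 0 < Re (holomorphic_section_norm.P h F' W y)"
    and Ginv: "\<And>j q. (\<Sum>i\<in>UNIV. G i j (\<chi> i. F i x) * Ginv i q) = (if q = j then 1 else 0)"
    and psd: "\<And>a. 0 \<le> Re (sesq (\<lambda>i j. G i j (\<chi> i. F i x)) a a)"
    and R: "\<And>k l i j. R k l i j = - wd k (wdbar l (G i j)) (\<chi> i. F i x)
      + (\<Sum>p\<in>UNIV. \<Sum>q\<in>UNIV. Ginv p q * wd k (G i q) (\<chi> i. F i x) * wdbar l (G p j) (\<chi> i. F i x))"
  shows "form_ge I (ddbar (\<lambda>y. holomorphic_section_norm.P G F V y / holomorphic_section_norm.P h F' W y) x)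
    (\<lambda>s t. ddbar (\<lambda>y. Ln (inverse (holomorphic_section_norm.P h F' W y))) x s t
        * (holomorphic_section_norm.P G F V x / holomorphic_section_norm.P h F' W x)
      - (\<Sum>k\<in>UNIV. \<Sum>l\<in>UNIV. \<Sum>i\<in>UNIV. \<Sum>j\<in>UNIV.
        R k l i j * wd s (F k) x * cnj (wd t (F l) x) * V i x * cnj (V j x)) / holomorphic_section_norm.P h F' W x)"
proof -
  interpret N: holomorphic_section_norm U D G F V by (rule N)
  interpret H: holomorphic_section_norm U E h F' W by (rule H)
  have H_real: "H.P y = complex_of_real (Re (H.P y))" if "y \<in> U" for y
    using H.P_cnj[OF that] by (metis Reals_cnj_iff of_real_Re)
  have H_nz: "H.P y \<noteq> 0" if "y \<in> U" for y
    using pos[OF that] by auto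
  have H_ln: "inverse (H.P y) \<notin> \<real>\<^sub>\<le>\<^sub>0" if "y \<in> U" for y
  proof -
    have "inverse (H.P y) = complex_of_real (inverse (Re (H.P y)))"
      by (subst H_real[OF that]) simp
    moreover have "inverse (Re (H.P y)) > 0" using pos[OF that] by simp
    ultimately show ?thesis by (metis complex_nonpos_Reals_iff Re_complex_of_real not_le)
  qed
  let ?B = "sesq (\<lambda>i j. G i j (\<chi> i. F i x))"
  let ?C = "\<lambda>s t. \<Sum>k\<in>UNIV. \<Sum>l\<in>UNIV. \<Sum>i\<in>UNIV. \<Sum>j\<in>UNIV.
        R k l i j * wd s (F k) x * cnj (wd t (F l) x) * V i x * cnj (V j x)"
  obtain Z where Z1: "\<And>s. N.Pd s x = ?B (Z s) (\<lambda>i. V i x)"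
    and Z2: "\<And>s t. N.Pdd s t x + ?C s t = ?B (Z s) (Z t)"
    using N.gram_representation[OF x Ginv R] by blast
  have B_cnj: "cnj (?B a b) = ?B b a" for a b
    by (rule sesq_cnj) (rule N.G_cnj[OF N.FD[OF x]])
  have C_cnj: "cnj (?C s t) = ?C t s" for s t
  proof -
    have C: "?C s t = ?B (Z s) (Z t) - N.Pdd s t x" for s t
      using Z2[of s t] by (simp only: eq_diff_eq add.commute)
    show ?thesis
      unfolding C complex_cnj_diff B_cnj N.Pdd_cnj[OF x] by (rule refl)
  qed
  have NP: "N.P x = ?B (\<lambda>i. V i x) (\<lambda>i. V i x)"
    by (simp add: N.P_def sesq_def mult.assoc)
  have Y: "ddbar (\<lambda>y. N.P y / H.P y) x s t = N.Pdd s t x / H.P x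
     - (N.Pdbar t x * H.Pd s x + N.Pd s x * H.Pdbar t x) / (H.P x)\<^sup>2
     - N.P x * H.Pdd s t x / (H.P x)\<^sup>2 + 2 * N.P x * H.Pd s x * H.Pdbar t x / (H.P x) ^ 3" for s t
    by (rule ddbar_quotient[OF N.U x N.has_wirtinger_P N.has_wirtinger_Pdbar[OF x]
          H.has_wirtinger_P H.has_wirtinger_Pdbar[OF x] H_nz])
  have L: "ddbar (\<lambda>y. Ln (inverse (H.P y))) x s t = H.Pd s x * H.Pdbar t x / (H.P x)\<^sup>2 - H.Pdd s t x / H.P x" for s t
    by (rule ddbar_Ln_inverse[OF N.U x H.has_wirtinger_P H.has_wirtinger_Pdbar[OF x] H_ln])
  note cnjs = N.P_cnj[OF x] N.Pd_cnj[OF x] N.Pdd_cnj[OF x] H.P_cnj[OF x] H.Pd_cnj[OF x] H.Pdd_cnj[OF x]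
  have Pdbar_cnj: "cnj (N.Pdbar s x) = N.Pd s x" "cnj (H.Pdbar s x) = H.Pd s x" for s
    by (simp_all add: N.Pd_cnj[OF x, symmetric] H.Pd_cnj[OF x, symmetric])
  define q where "q s i = Z s i - H.Pd s x / H.P x * V i x" for s i
  have key: "ddbar (\<lambda>y. N.P y / H.P y) x s t
      - (ddbar (\<lambda>y. Ln (inverse (H.P y))) x s t * (N.P x / H.P x) - ?C s t / H.P x)
      = ?B (q s) (q t) / H.P x" for s t
  proof -
    have Bq: "?B (q s) (q t) = (N.Pdd s t x + ?C s t) - H.Pdbar t x / H.P x * N.Pd s x
        - H.Pd s x / H.P x * N.Pdbar t x + H.Pd s x / H.P x * (H.Pdbar t x / H.P x) * N.P x"
    proof -
      have "?B (\<lambda>i. V i x) (Z t) = N.Pdbar t x"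
        using B_cnj[of "Z t" "\<lambda>i. V i x"] by (simp add: Z1[symmetric] cnjs)
      then show ?thesis
        unfolding q_def[abs_def] sesq_diff_left sesq_diff_right sesq_scale_left sesq_scale_right Z2
        by (simp add: Z1[symmetric] NP[symmetric] cnjs)
    qed
    \<comment> \<open>All that is left is an identity of rational functions in the values of the derivatives.\<close>
    have rational: "p / H - (b * e + d * g) / H\<^sup>2 - n * k / H\<^sup>2 + 2 * n * e * g / H ^ 3
        - ((e * g / H\<^sup>2 - k / H) * (n / H) - c / H)
      = ((p + c) - g / H * d - e / H * b + e / H * (g / H) * n) / H"
      if "H \<noteq> 0" for p H b e d g n k c :: complex
      using that by (simp add: divide_simps power2_eq_square power3_eq_cube) (simp add: algebra_simps)
    show ?thesis
      unfolding Bq Y L by (rule rational[OF H_nz[OF x]])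
  qed
  show ?thesis
    unfolding form_ge_def
  proof (intro conjI allI)
    show "real_form I (ddbar (\<lambda>y. N.P y / H.P y) x)"
      unfolding real_form_def Y by (simp add: cnjs Pdbar_cnj mult_ac add_ac)
    show "real_form I (\<lambda>s t. ddbar (\<lambda>y. Ln (inverse (H.P y))) x s t * (N.P x / H.P x) - ?C s t / H.P x)"
      unfolding real_form_def L
      by (simp only: complex_cnj_diff complex_cnj_mult complex_cnj_divide complex_cnj_power C_cnj cnjs Pdbar_cnj)
         (simp add: mult.commute)
  next
    fix \<xi> :: "'k \<Rightarrow> complex"
    let ?S = "\<Sum>s\<in>I. \<Sum>t\<in>I. ?B (q s) (q t) * \<xi> s * cnj (\<xi> t)"
    have "(\<Sum>s\<in>I. \<Sum>t\<in>I. (ddbar (\<lambda>y. N.P y / H.P y) x s t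
      - (ddbar (\<lambda>y. Ln (inverse (H.P y))) x s t * (N.P x / H.P x) - ?C s t / H.P x)) * \<xi> s * cnj (\<xi> t))
      = ?S / H.P x"
      unfolding key by (simp add: sum_divide_distrib)
    moreover have "Re (?S / H.P x) = Re ?S / Re (H.P x)"
      by (subst H_real[OF x]) (rule Re_divide_of_real)
    moreover have "0 \<le> Re ?S / Re (H.P x)"
      using sesq_gram_nonneg[OF psd] pos[OF x] by (intro divide_nonneg_pos)
    ultimately show "0 \<le> Re (\<Sum>s\<in>I. \<Sum>t\<in>I. (ddbar (\<lambda>y. N.P y / H.P y) x s t
      - (ddbar (\<lambda>y. Ln (inverse (H.P y))) x s t * (N.P x / H.P x) - ?C s t / H.P x)) * \<xi> s * cnj (\<xi> t))"
      by (simp only:)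
  qed
qed

section \<open>Charts and Jacobians\<close>

text \<open>Jacobians are defined by single partial derivatives. A complex-linear differential determines
  them, which is how the chain rule for Jacobians follows from the one for differentials.\<close>

lemma jacobian_eqI:
  fixes \<Phi> :: "complex ^ 'm::finite \<Rightarrow> complex ^ 'n::finite"
  assumes "(\<Phi> has_derivative (\<lambda>v. M *v v)) (at z)"
  shows "(\<chi> i j. wd j (\<lambda>z. \<Phi> z $ i) z) = M"
proof -
  have "wd j (\<lambda>z. \<Phi> z $ i) z = M $ i $ j" for i j
  proof (rule has_wirtinger_wd)
    have "((\<lambda>t. \<Phi> (z + axis j t) $ i) has_derivative (\<lambda>t. (M *v axis j t) $ i)) (at 0)"
      using has_derivative_compose[OF has_derivative_axis_line, of \<Phi> "\<lambda>v. M *v v" z j 0] assms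
      by (intro bounded_linear.has_derivative[OF bounded_linear_vec_nth]) simp
    moreover have "(M *v axis j t) $ i = M $ i $ j * t + 0 * cnj t" for t
      by (simp add: matrix_vector_mult_def axis_component if_distrib cong: if_cong)
    ultimately show "has_wirtinger (\<lambda>z. \<Phi> z $ i) j z (M $ i $ j) 0"
      unfolding has_wirtinger_def by (simp only:)
  qed
  then show ?thesis by (simp add: vec_eq_iff)
qed

lemma holo_on_has_jacobian:
  fixes \<Phi> :: "complex ^ 'm::finite \<Rightarrow> complex ^ 'n::finite"
  assumes "holo_on S \<Phi>" "z \<in> S"
  shows "(\<Phi> has_derivative (\<lambda>v. (\<chi> i j. wd j (\<lambda>z. \<Phi> z $ i) z) *v v)) (at z)"
proof -
  obtain \<Phi>' where d: "(\<Phi> has_derivative \<Phi>') (at z)" and lin: "\<And>k v. \<Phi>' (k *s v) = k *s \<Phi>' v"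
    using assms unfolding holo_on_def by blast
  define M where "M = (\<chi> i j. \<Phi>' (axis j 1) $ i)"
  interpret L: bounded_linear \<Phi>' using has_derivative_bounded_linear[OF d] .
  have M: "\<Phi>' v = M *v v" for v
  proof -
    have "\<Phi>' v = \<Phi>' (\<Sum>j\<in>UNIV. axis j (v $ j))"
      by (rule arg_cong[where f = \<Phi>'], rule complex_vec_axis_sum)
    also have "\<dots> = (\<Sum>j\<in>UNIV. \<Phi>' (axis j (v $ j)))" by (rule L.sum)
    also have "\<dots> = (\<Sum>j\<in>UNIV. v $ j *s \<Phi>' (axis j 1))"
    proof (rule sum.cong[OF refl])
      fix j
      have "axis j (v $ j) = v $ j *s axis j 1" by (simp add: vec_eq_iff axis_component)
      then show "\<Phi>' (axis j (v $ j)) = v $ j *s \<Phi>' (axis j 1)" by (rule trans[OF arg_cong[where f = \<Phi>'] lin])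
    qed
    also have "\<dots> = M *v v" by (simp add: M_def vec_eq_iff matrix_vector_mult_def mult.commute)
    finally show ?thesis .
  qed
  have d': "(\<Phi> has_derivative (\<lambda>v. M *v v)) (at z)" using d unfolding M[abs_def] .
  show ?thesis unfolding jacobian_eqI[OF d'] by (rule d')
qed

lemma complex_manifold_chart:
  assumes "complex_manifold X A" "c \<in> A"
  shows "openin X (fst c)" "open (snd c ` fst c)" "inj_on (snd c) (fst c)"
    and "openin X S \<Longrightarrow> open (snd c ` (fst c \<inter> S))"
proof -
  have op: "openin X (fst c)" "open (snd c ` fst c)"
    and hom: "homeomorphic_map (subtopology X (fst c)) (top_of_set (snd c ` fst c)) (snd c)"
    using assms unfolding complex_manifold_def by blast+
  show "openin X (fst c)" "open (snd c ` fst c)" by fact+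
  have top: "topspace (subtopology X (fst c)) = fst c"
    using openin_subset[OF op(1)] by auto
  show "inj_on (snd c) (fst c)"
    using homeomorphic_imp_injective_map[OF hom] unfolding top .
  assume "openin X S"
  then have "openin (subtopology X (fst c)) (fst c \<inter> S)"
    by (simp add: openin_subtopology_Int2)
  then have "openin (top_of_set (snd c ` fst c)) (snd c ` (fst c \<inter> S))"
    using homeomorphic_imp_open_map[OF hom] unfolding open_map_def by blast
  then show "open (snd c ` (fst c \<inter> S))"
    using op(2) openin_open_eq by blast
qed

lemma chart_inv_left: "inj_on (snd c) (fst c) \<Longrightarrow> p \<in> fst c \<Longrightarrow> chart_inv c (snd c p) = p"
  unfolding chart_inv_def by (rule inv_into_f_f)

lemma chart_inv_right: "z \<in> snd c ` fst c \<Longrightarrow> snd c (chart_inv c z) = z"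
  unfolding chart_inv_def by (rule f_inv_into_f)

lemma chart_inv_in: "z \<in> snd c ` fst c \<Longrightarrow> chart_inv c z \<in> fst c"
  unfolding chart_inv_def by (rule inv_into_into)

lemma holomorphic_map_domain:
  assumes X: "complex_manifold X A" and Y: "complex_manifold Y B" and f: "holomorphic_map X A Y B f"
    and c: "c \<in> A" and d: "d \<in> B"
  shows "open (snd c ` (fst c \<inter> f -` fst d))"
proof -
  have "openin X {p \<in> topspace X. f p \<in> fst d}"
    using f complex_manifold_chart(1)[OF Y d] unfolding holomorphic_map_def
    by (auto intro: openin_continuous_map_preimage)
  moreover have "fst c \<inter> f -` fst d = fst c \<inter> {p \<in> topspace X. f p \<in> fst d}"
    using openin_subset[OF complex_manifold_chart(1)[OF X c]] by auto
  ultimately show ?thesis using complex_manifold_chart(4)[OF X c] by simp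
qed

lemma map_jac_has_derivative:
  assumes f: "holomorphic_map X A Y B f" and c: "c \<in> A" and d: "d \<in> B" and p: "p \<in> fst c" "f p \<in> fst d"
  shows "((snd d \<circ> f \<circ> chart_inv c) has_derivative (\<lambda>v. map_jac c d f p *v v)) (at (snd c p))"
proof -
  have "holo_on (snd c ` (fst c \<inter> f -` fst d)) (snd d \<circ> f \<circ> chart_inv c)"
    using f c d unfolding holomorphic_map_def by blast
  from holo_on_has_jacobian[OF this] p show ?thesis
    unfolding map_jac_def by (simp add: image_iff) blast
qed

lemma holomorphic_map_id: "complex_manifold X A \<Longrightarrow> holomorphic_map X A X A id"
  unfolding holomorphic_map_def complex_manifold_def by simp

text \<open>With the identity map for one of the factors, this is the law for changing charts in the source or
  in the target.\<close>

lemma map_jac_compose: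
  assumes X: "complex_manifold X A" and Y: "complex_manifold Y B"
    and g: "holomorphic_map X A Y B g" and f: "holomorphic_map Y B Z C f"
    and c: "c \<in> A" and d: "d \<in> B" and e: "e \<in> C"
    and p: "p \<in> fst c" "g p \<in> fst d" "f (g p) \<in> fst e"
  shows "map_jac c e (\<lambda>q. f (g q)) p = map_jac d e f (g p) ** map_jac c d g p"
proof -
  note ic = complex_manifold_chart(3)[OF X c] and id = complex_manifold_chart(3)[OF Y d]
  have z: "(snd d \<circ> g \<circ> chart_inv c) (snd c p) = snd d (g p)"
    using p by (simp add: chart_inv_left[OF ic])
  have "((\<lambda>z. (snd e \<circ> f \<circ> chart_inv d) ((snd d \<circ> g \<circ> chart_inv c) z)) has_derivative
      (\<lambda>v. map_jac d e f (g p) *v (map_jac c d g p *v v))) (at (snd c p))"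
    by (rule has_derivative_compose[OF map_jac_has_derivative[OF g c d p(1,2)]])
       (unfold z, rule map_jac_has_derivative[OF f d e p(2,3)])
  then have "((\<lambda>z. snd e (f (g (chart_inv c z)))) has_derivative
      (\<lambda>v. (map_jac d e f (g p) ** map_jac c d g p) *v v)) (at (snd c p))"
    unfolding matrix_vector_mul_assoc
  proof (rule has_derivative_transform_within_open[OF _ holomorphic_map_domain[OF X Y g c d]])
    show "snd c p \<in> snd c ` (fst c \<inter> g -` fst d)" using p by blast
    fix z assume "z \<in> snd c ` (fst c \<inter> g -` fst d)"
    then obtain q where q: "q \<in> fst c" "g q \<in> fst d" "z = snd c q" by blast
    then show "(snd e \<circ> f \<circ> chart_inv d) ((snd d \<circ> g \<circ> chart_inv c) z) = snd e (f (g (chart_inv c z)))"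
      by (simp add: chart_inv_left[OF ic] chart_inv_left[OF id])
  qed
  from jacobian_eqI[OF this] show ?thesis unfolding map_jac_def[of c e] .
qed

lemma map_jac_id:
  assumes X: "complex_manifold X A" and c: "c \<in> A" and p: "p \<in> fst c"
  shows "map_jac c c id p = mat 1"
proof -
  have "((\<lambda>z. snd c (id (chart_inv c z))) has_derivative (\<lambda>v. mat 1 *v v)) (at (snd c p))"
  proof (rule has_derivative_transform_within_open[OF _ complex_manifold_chart(2)[OF X c]])
    show "((\<lambda>z. z) has_derivative (\<lambda>v. mat 1 *v v)) (at (snd c p))" by simp
  qed (use p in \<open>simp_all add: chart_inv_right\<close>)
  from jacobian_eqI[OF this] show ?thesis unfolding map_jac_def .
qed

section \<open>Tangent vectors and metrics in coordinates\<close>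

definition tvec_of_coords :: "('a, 'm::finite) chart set \<Rightarrow> ('a, 'm) chart \<Rightarrow> 'a \<Rightarrow> complex ^ 'm \<Rightarrow> ('a, 'm) tvec" where
  "tvec_of_coords A c p w = (\<lambda>d. if d \<in> A \<and> p \<in> fst d then map_jac c d id p *v w else 0)"

lemma coord_frame_eq: "coord_frame A c p \<alpha> = tvec_of_coords A c p (axis \<alpha> 1)"
  unfolding coord_frame_def tvec_of_coords_def ..

lemma tvec_of_coords_chart:
  assumes "complex_manifold X A" "c \<in> A" "p \<in> fst c"
  shows "tvec_of_coords A c p w c = w"
  using assms map_jac_id[OF assms] by (simp add: tvec_of_coords_def)

text \<open>The compatibility of the coordinates in two charts is the cocycle law of the coordinate changes.\<close>

lemma tvec_of_coords_tangent:
  assumes X: "complex_manifold X A" and c: "c \<in> A" "p \<in> fst c"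
  shows "tvec_of_coords A c p w \<in> tangent_space A p"
proof -
  have cocycle: "map_jac c e id p *v w = map_jac d e id p *v (map_jac c d id p *v w)"
    if "d \<in> A" "e \<in> A" "p \<in> fst d" "p \<in> fst e" for d e
  proof -
    note i = holomorphic_map_id[OF X]
    from map_jac_compose[OF X X i i c(1) that(1,2)] c(2) that(3,4)
    have "map_jac c e (\<lambda>q. q) p = map_jac d e id p ** map_jac c d id p" by simp
    then show ?thesis by (simp add: matrix_vector_mul_assoc id_def)
  qed
  show ?thesis
    unfolding tangent_space_def mem_Collect_eq
  proof (intro conjI allI ballI impI)
    fix d e assume "d \<in> A" "e \<in> A" "p \<in> fst d \<inter> fst e"
    then have de: "d \<in> A" "e \<in> A" "p \<in> fst d" "p \<in> fst e" by auto
    then show "tvec_of_coords A c p w e = map_jac d e id p *v tvec_of_coords A c p w d"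
      unfolding tvec_of_coords_def by (simp only: if_True simp_thms cocycle[OF de])
  next
    fix d assume "\<not> (d \<in> A \<and> p \<in> fst d)"
    then show "tvec_of_coords A c p w d = 0" unfolding tvec_of_coords_def by (simp only: if_False)
  qed
qed

lemma tvec_of_coords_eq:
  assumes "v \<in> tangent_space A p" "c \<in> A" "p \<in> fst c"
  shows "tvec_of_coords A c p (v c) = v"
proof (rule ext)
  fix d
  show "tvec_of_coords A c p (v c) d = v d"
  proof (cases "d \<in> A \<and> p \<in> fst d")
    case True
    have "tvec_of_coords A c p (v c) d = map_jac c d id p *v v c"
      using True by (simp only: tvec_of_coords_def if_True simp_thms)
    also have "\<dots> = v d"
      by (rule sym) (use True assms in \<open>unfold tangent_space_def, blast\<close>)
    finally show ?thesis .
  next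
    case False
    then have "v d = 0" using assms(1) unfolding tangent_space_def by blast
    then show ?thesis using False by (simp only: tvec_of_coords_def if_False)
  qed
qed

lemma tvec_of_coords_add: "tvec_of_coords A c p (w + w') = tadd (tvec_of_coords A c p w) (tvec_of_coords A c p w')"
  by (auto simp: tvec_of_coords_def tadd_def matrix_vector_right_distrib)

lemma tvec_of_coords_scale: "tvec_of_coords A c p (k *s w) = tscale k (tvec_of_coords A c p w)"
  by (auto simp: tvec_of_coords_def tscale_def vec.scale)

lemma metric_tvec_of_coords_left:
  assumes X: "complex_manifold X A" and h: "hermitian_metric X A h"
    and c: "c \<in> A" "p \<in> fst c" and u: "u \<in> tangent_space A p"
  shows "h p (tvec_of_coords A c p w) u = (\<Sum>\<alpha>\<in>UNIV. w $ \<alpha> * h p (coord_frame A c p \<alpha>) u)"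
proof -
  have p: "p \<in> topspace X" using openin_subset[OF complex_manifold_chart(1)[OF X c(1)]] c(2) by blast
  note T = tvec_of_coords_tangent[OF X c]
  have add: "h p (tvec_of_coords A c p (w + w')) u = h p (tvec_of_coords A c p w) u + h p (tvec_of_coords A c p w') u" for w w'
    unfolding tvec_of_coords_add using h p T u unfolding hermitian_metric_def by blast
  have scale: "h p (tvec_of_coords A c p (k *s w)) u = k * h p (tvec_of_coords A c p w) u" for k w
    unfolding tvec_of_coords_scale using h p T u unfolding hermitian_metric_def by blast
  have "h p (tvec_of_coords A c p (\<Sum>\<alpha>\<in>S. w $ \<alpha> *s axis \<alpha> 1)) u = (\<Sum>\<alpha>\<in>S. w $ \<alpha> * h p (coord_frame A c p \<alpha>) u)"
    if "finite S" for S
    using that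
  proof induction
    case empty
    show ?case using scale[of 0 0] by simp
  next
    case (insert \<alpha> S)
    then show ?case by (simp add: add scale coord_frame_eq)
  qed
  from this[OF finite[of UNIV]] show ?thesis unfolding basis_expansion .
qed

lemma metric_in_coordinates:
  assumes X: "complex_manifold X A" and h: "hermitian_metric X A h"
    and c: "c \<in> A" "p \<in> fst c" and u: "u \<in> tangent_space A p" and v: "v \<in> tangent_space A p"
  shows "h p u v = sesq (metric_coeff A h c p) (\<lambda>i. u c $ i) (\<lambda>i. v c $ i)"
proof -
  have p: "p \<in> topspace X" using openin_subset[OF complex_manifold_chart(1)[OF X c(1)]] c(2) by blast
  have cf: "coord_frame A c p \<alpha> \<in> tangent_space A p" for \<alpha>
    unfolding coord_frame_eq by (rule tvec_of_coords_tangent[OF X c])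
  have sym: "h p a b = cnj (h p b a)" if "a \<in> tangent_space A p" "b \<in> tangent_space A p" for a b
    using h p that unfolding hermitian_metric_def by blast
  have L: "h p a b = (\<Sum>\<alpha>\<in>UNIV. a c $ \<alpha> * h p (coord_frame A c p \<alpha>) b)"
    if "a \<in> tangent_space A p" "b \<in> tangent_space A p" for a b
    using metric_tvec_of_coords_left[OF X h c that(2), of "a c"] unfolding tvec_of_coords_eq[OF that(1) c] .
  have "h p (coord_frame A c p \<alpha>) v = (\<Sum>\<beta>\<in>UNIV. cnj (v c $ \<beta>) * metric_coeff A h c p \<alpha> \<beta>)" for \<alpha>
  proof -
    have "h p (coord_frame A c p \<alpha>) v = cnj (\<Sum>\<beta>\<in>UNIV. v c $ \<beta> * h p (coord_frame A c p \<beta>) (coord_frame A c p \<alpha>))"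
      unfolding sym[OF cf v] L[OF v cf] ..
    also have "\<dots> = (\<Sum>\<beta>\<in>UNIV. cnj (v c $ \<beta>) * cnj (h p (coord_frame A c p \<beta>) (coord_frame A c p \<alpha>)))"
      by simp
    also have "\<dots> = (\<Sum>\<beta>\<in>UNIV. cnj (v c $ \<beta>) * metric_coeff A h c p \<alpha> \<beta>)"
      unfolding metric_coeff_def sym[OF cf cf, symmetric] ..
    finally show ?thesis .
  qed
  then show ?thesis
    unfolding L[OF u v] sesq_def by (simp add: sum_distrib_left mult_ac)
qed

lemma metric_coeff_cnj:
  assumes X: "complex_manifold X A" and h: "hermitian_metric X A h" and c: "c \<in> A" "p \<in> fst c"
  shows "cnj (metric_coeff A h c p \<alpha> \<beta>) = metric_coeff A h c p \<beta> \<alpha>"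
proof -
  have p: "p \<in> topspace X" using openin_subset[OF complex_manifold_chart(1)[OF X c(1)]] c(2) by blast
  have cf: "coord_frame A c p \<alpha> \<in> tangent_space A p" for \<alpha>
    unfolding coord_frame_eq by (rule tvec_of_coords_tangent[OF X c])
  have "h p a b = cnj (h p b a)" if "a \<in> tangent_space A p" "b \<in> tangent_space A p" for a b
    using h p that unfolding hermitian_metric_def by blast
  from this[OF cf cf] show ?thesis unfolding metric_coeff_def by metis
qed

lemma metric_coeff_pos:
  assumes X: "complex_manifold X A" and h: "hermitian_metric X A h" and c: "c \<in> A" "p \<in> fst c"
    and a: "a \<noteq> (\<lambda>_. 0)"
  shows "0 < Re (sesq (metric_coeff A h c p) a a)"
proof -
  have p: "p \<in> topspace X" using openin_subset[OF complex_manifold_chart(1)[OF X c(1)]] c(2) by blast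
  define v where "v = tvec_of_coords A c p (\<chi> i. a i)"
  have v: "v \<in> tangent_space A p" unfolding v_def by (rule tvec_of_coords_tangent[OF X c])
  have vc: "v c = (\<chi> i. a i)" unfolding v_def by (rule tvec_of_coords_chart[OF X c])
  have "(\<chi> i. a i) \<noteq> 0" using a by (auto simp: vec_eq_iff fun_eq_iff)
  then have "v \<noteq> tzero" using vc unfolding tzero_def by metis
  then have "0 < Re (h p v v)" using h p v unfolding hermitian_metric_def by blast
  then show ?thesis unfolding metric_in_coordinates[OF X h c v v] vc by (simp add: vec_lambda_inverse)
qed

text \<open>Definiteness makes the matrix of the metric injective, so that the matrix inverse is a true one.\<close>

lemma metric_inv_inverse:
  assumes X: "complex_manifold X A" and h: "hermitian_metric X A h" and c: "c \<in> A" "p \<in> fst c"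
  shows "(\<Sum>i\<in>UNIV. metric_coeff A h c p i j * metric_inv A h c p i q) = (if q = j then 1 else 0)"
proof -
  define M where "M = (\<chi> i j. metric_coeff A h c p i j)"
  have "x = 0" if "M *v x = 0" for x
  proof (rule ccontr)
    assume "x \<noteq> 0"
    then have "(\<lambda>i. cnj (x $ i)) \<noteq> (\<lambda>_. 0)" by (auto simp: vec_eq_iff fun_eq_iff)
    from metric_coeff_pos[OF X h c this]
    have "0 < Re (\<Sum>i\<in>UNIV. cnj (x $ i) * (M *v x) $ i)"
      by (simp add: sesq_def M_def matrix_vector_mult_def sum_distrib_left mult_ac)
    with that show False by simp
  qed
  then have "invertible M"
    unfolding invertible_left_inverse matrix_left_invertible_ker by blast
  then have "matrix_inv M ** M = mat 1"
    unfolding invertible_def matrix_inv_def by (metis (mono_tags, lifting) someI_ex)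
  then have "(matrix_inv M ** M) $ q $ j = (if q = j then 1 else 0)"
    by (simp add: mat_def)
  moreover have "(matrix_inv M ** M) $ q $ j = (\<Sum>i\<in>UNIV. metric_coeff A h c p i j * metric_inv A h c p i q)"
    by (simp add: matrix_matrix_mult_def metric_inv_def M_def mult.commute)
  ultimately show ?thesis by simp
qed

section \<open>The function on the projectivised tangent bundle\<close>

text \<open>By the chain rule, the images computed with two choices of charts differ by the Jacobian of the
  coordinate change in the target: they are coordinates of one and the same tangent vector.\<close>

lemma pushforward_coords:
  assumes X: "complex_manifold X A" and Y: "complex_manifold Y B" and f: "holomorphic_map X A Y B f"
    and v: "v \<in> tangent_space A p" and c: "c \<in> A" "p \<in> fst c" and c': "c' \<in> A" "p \<in> fst c'"
    and d: "d \<in> B" "f p \<in> fst d" and d': "d' \<in> B" "f p \<in> fst d'"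
  shows "map_jac c' d' f p *v v c' = map_jac d d' id (f p) *v (map_jac c d f p *v v c)"
proof -
  have 1: "map_jac c d' f p = map_jac d d' id (f p) ** map_jac c d f p"
    using map_jac_compose[OF X Y f holomorphic_map_id[OF Y] c(1) d(1) d'(1) c(2) d(2)] d'(2) by simp
  have 2: "map_jac c d' f p = map_jac c' d' f p ** map_jac c c' id p"
    using map_jac_compose[OF X X holomorphic_map_id[OF X] f c(1) c'(1) d'(1) c(2)] c'(2) d'(2) by simp
  have "v c' = map_jac c c' id p *v v c"
    using v c c' unfolding tangent_space_def by blast
  then have "map_jac c' d' f p *v v c' = map_jac c d' f p *v v c"
    unfolding 2 by (simp only: matrix_vector_mul_assoc)
  then show ?thesis unfolding 1 by (simp only: matrix_vector_mul_assoc)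
qed

lemma H_local_sesq: "H_local A h c p W = sesq (metric_coeff A h c p) (\<lambda>i. W $ i) (\<lambda>i. W $ i)"
  by (simp add: H_local_def sesq_def)

lemma Y_local_sesq:
  "Y_local A h B g f c d p W =
     sesq (metric_coeff B g d (f p)) (\<lambda>i. (map_jac c d f p *v W) $ i) (\<lambda>i. (map_jac c d f p *v W) $ i)
     / H_local A h c p W"
proof -
  let ?J = "map_jac c d f p"
  have "metric_coeff B g d (f p) i j * (?J *v W) $ i * cnj ((?J *v W) $ j) / H_local A h c p W =
    (\<Sum>\<alpha>\<in>UNIV. \<Sum>\<beta>\<in>UNIV. metric_coeff B g d (f p) i j * ?J $ i $ \<alpha> * cnj (?J $ j $ \<beta>)
        * (W $ \<alpha> * cnj (W $ \<beta>) / H_local A h c p W))" for i j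
  proof -
    have "(?J *v W) $ i * cnj ((?J *v W) $ j) =
        (\<Sum>\<alpha>\<in>UNIV. \<Sum>\<beta>\<in>UNIV. (?J $ i $ \<alpha> * W $ \<alpha>) * (cnj (?J $ j $ \<beta>) * cnj (W $ \<beta>)))"
      by (simp add: matrix_vector_mult_def sum_product)
    then have "metric_coeff B g d (f p) i j * ((?J *v W) $ i * cnj ((?J *v W) $ j)) / H_local A h c p W =
        metric_coeff B g d (f p) i j *
        (\<Sum>\<alpha>\<in>UNIV. \<Sum>\<beta>\<in>UNIV. (?J $ i $ \<alpha> * W $ \<alpha>) * (cnj (?J $ j $ \<beta>) * cnj (W $ \<beta>))) / H_local A h c p W"
      by (simp only:)
    then show ?thesis
      by (simp add: sum_distrib_left sum_divide_distrib mult_ac)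
  qed
  then show ?thesis
    by (simp add: Y_local_def sesq_def sum_divide_distrib)
qed

lemma Y_local_scale:
  assumes "k \<noteq> 0"
  shows "Y_local A h B g f c d p (k *s W) = Y_local A h B g f c d p W"
proof -
  have "sesq G (\<lambda>i. (k *s w) $ i) (\<lambda>i. (k *s w) $ i) = (k * cnj k) * sesq G (\<lambda>i. w $ i) (\<lambda>i. w $ i)"
    for G :: "'x::finite \<Rightarrow> 'x \<Rightarrow> complex" and w
    unfolding vector_smult_component sesq_scale_left sesq_scale_right by (simp add: mult_ac)
  note scale = this
  show ?thesis
    using assms unfolding Y_local_sesq H_local_sesq vec.scale scale by simp
qed

text \<open>In any charts the local expression is \<open>g(u, u) / h(v, v)\<close>, where \<open>u\<close> is the image of \<open>v\<close>.\<close>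

lemma Y_local_intrinsic:
  assumes X: "hermitian_manifold X A h" and Y: "hermitian_manifold Y B g" and f: "holomorphic_map X A Y B f"
    and v: "v \<in> tangent_space A p" and c: "c \<in> A" "p \<in> fst c" and c': "c' \<in> A" "p \<in> fst c'"
    and d: "d \<in> B" "f p \<in> fst d" and d': "d' \<in> B" "f p \<in> fst d'"
  shows "Y_local A h B g f c' d' p (v c') = Y_local A h B g f c d p (v c)"
proof -
  have X': "complex_manifold X A" "hermitian_metric X A h" and Y': "complex_manifold Y B" "hermitian_metric Y B g"
    using X Y unfolding hermitian_manifold_def by blast+
  define u where "u = tvec_of_coords B d (f p) (map_jac c d f p *v v c)"
  have u: "u \<in> tangent_space B (f p)" unfolding u_def by (rule tvec_of_coords_tangent[OF Y'(1) d])
  have ud: "u e = map_jac b e f p *v v b" if b: "b \<in> A" "p \<in> fst b" and e: "e \<in> B" "f p \<in> fst e" for b e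
    unfolding pushforward_coords[OF X'(1) Y'(1) f v c b d e] u_def tvec_of_coords_def
    using e by (simp only: if_True simp_thms)
  have "Y_local A h B g f b e p (v b) = g (f p) u u / h p v v"
    if b: "b \<in> A" "p \<in> fst b" and e: "e \<in> B" "f p \<in> fst e" for b e
    unfolding Y_local_sesq H_local_sesq metric_in_coordinates[OF X' b v v] metric_in_coordinates[OF Y' e u u]
      ud[OF b e] ..
  from this[OF c' d'] this[OF c d] show ?thesis by (simp only:)
qed

lemma tscale_tangent:
  assumes "v \<in> tangent_space A p"
  shows "tscale k v \<in> tangent_space A p"
  unfolding tangent_space_def mem_Collect_eq
proof (intro conjI allI ballI impI)
  fix c assume "\<not> (c \<in> A \<and> p \<in> fst c)"
  with assms have "v c = 0" unfolding tangent_space_def by blast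
  then show "tscale k v c = 0" by (simp add: tscale_def)
next
  fix c d assume "c \<in> A" "d \<in> A" "p \<in> fst c \<inter> fst d"
  with assms have "v d = map_jac c d id p *v v c" unfolding tangent_space_def by blast
  then have "k *s v d = k *s (map_jac c d id p *v v c)" by (rule arg_cong)
  then show "tscale k v d = map_jac c d id p *v tscale k v c"
    unfolding tscale_def vec.scale .
qed

lemma tscale_tscale: "tscale k (tscale l v) = tscale (k * l) v"
  by (simp add: tscale_def vector_smult_assoc)

lemma Y_fun_eq_Y_local:
  assumes X: "hermitian_manifold X A h" and Y: "hermitian_manifold Y B g" and f: "holomorphic_map X A Y B f"
    and v: "v \<in> tangent_space A p" "v \<noteq> tzero"
    and c: "c \<in> A" "p \<in> fst c" and d: "d \<in> B" "f p \<in> fst d"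
  shows "Y_fun A h B g f (p, range (\<lambda>k. tscale k v)) = Y_local A h B g f c d p (v c)"
  unfolding Y_fun_def fst_conv snd_conv
proof (rule the_equality)
  show "\<forall>c'\<in>A. \<forall>d'\<in>B. \<forall>w\<in>range (\<lambda>k. tscale k v). p \<in> fst c' \<and> f p \<in> fst d' \<and> w \<noteq> tzero \<longrightarrow>
      Y_local A h B g f c d p (v c) = Y_local A h B g f c' d' p (w c')"
  proof (intro ballI impI)
    fix c' d' w
    assume c': "c' \<in> A" and d': "d' \<in> B" and w: "w \<in> range (\<lambda>k. tscale k v)"
      and *: "p \<in> fst c' \<and> f p \<in> fst d' \<and> w \<noteq> tzero"
    obtain k where k: "w = tscale k v" using w by blast
    then have "k \<noteq> 0" using * by (auto simp: tscale_def tzero_def)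
    then have "Y_local A h B g f c' d' p (w c') = Y_local A h B g f c' d' p (v c')"
      unfolding k tscale_def by (rule Y_local_scale)
    also have "\<dots> = Y_local A h B g f c d p (v c)"
      using Y_local_intrinsic[OF X Y f v(1) c c' _ d d'] * by blast
    finally show "Y_local A h B g f c d p (v c) = Y_local A h B g f c' d' p (w c')" ..
  qed
  fix y
  assume y: "\<forall>c'\<in>A. \<forall>d'\<in>B. \<forall>w\<in>range (\<lambda>k. tscale k v). p \<in> fst c' \<and> f p \<in> fst d' \<and> w \<noteq> tzero \<longrightarrow>
      y = Y_local A h B g f c' d' p (w c')"
  have "v = tscale 1 v" by (simp add: tscale_def)
  then have "v \<in> range (\<lambda>k. tscale k v)" by blast
  with y c d v(2) show "y = Y_local A h B g f c d p (v c)" by blast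
qed

text \<open>The chart picks out the one vector on the line whose coordinate \<open>a\<close> is 1.\<close>

lemma proj_chart_coords:
  assumes Q: "Q \<in> fst (proj_chart X A c a)"
  obtains v where "v \<in> tangent_space A (fst Q)" "v \<noteq> tzero" "snd Q = range (\<lambda>k. tscale k v)"
    "fst Q \<in> fst c" "v c $ a = 1"
    "base_part (snd (proj_chart X A c a) Q) = snd c (fst Q)"
    "fibre_part (snd (proj_chart X A c a) Q) = v c"
proof -
  have Qt: "Q \<in> proj_tangent X A" and p: "fst Q \<in> fst c" and ex: "\<exists>v\<in>snd Q. v c $ a \<noteq> 0"
    using Q unfolding proj_chart_def by auto
  obtain v0 where v0: "v0 \<in> tangent_space A (fst Q)" "snd Q = range (\<lambda>k. tscale k v0)"
    using Qt unfolding proj_tangent_def by auto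
  have nz: "v0 c $ a \<noteq> 0" using ex unfolding v0(2) by (auto simp: tscale_def)
  define v where "v = tscale (1 / v0 c $ a) v0"
  have vt: "v \<in> tangent_space A (fst Q)" unfolding v_def by (rule tscale_tangent[OF v0(1)])
  have va: "v c $ a = 1" using nz by (simp add: v_def tscale_def)
  have vz: "v \<noteq> tzero" using va by (auto simp: tzero_def)
  have range: "snd Q = range (\<lambda>k. tscale k v)"
  proof -
    have "tscale k v0 = tscale (k * v0 c $ a) v" for k
      using nz by (simp add: v_def tscale_tscale)
    moreover have "tscale k v = tscale (k / v0 c $ a) v0" for k
      by (simp add: v_def tscale_tscale)
    ultimately show ?thesis
      unfolding v0(2) by (intro equalityI image_subsetI) (rule range_eqI, blast)+
  qed
  have the: "(THE v. v \<in> snd Q \<and> v c $ a = 1) = v"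
  proof (rule the_equality)
    have "v = tscale 1 v" by (simp add: tscale_def)
    then show "v \<in> snd Q \<and> v c $ a = 1" unfolding range using va by blast
    fix w assume w: "w \<in> snd Q \<and> w c $ a = 1"
    then obtain k where k: "w = tscale k v" unfolding range by blast
    with w va have "k = 1" by (simp add: tscale_def)
    with k show "w = v" by (simp add: tscale_def)
  qed
  have "base_part (snd (proj_chart X A c a) Q) = snd c (fst Q)"
    by (simp add: base_part_def proj_chart_def vec_eq_iff)
  moreover have "fibre_part (snd (proj_chart X A c a) Q) = v c"
    by (simp add: fibre_part_def proj_chart_def vec_eq_iff the)
  ultimately show ?thesis using that[OF vt vz range p va] by blast
qed

lemma base_fibre_eqI: "base_part x = base_part y \<Longrightarrow> fibre_part x = fibre_part y \<Longrightarrow> x = y"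
  unfolding base_part_def fibre_part_def vec_eq_iff vec_lambda_beta by (metis sum.exhaust)

text \<open>The image of a projective chart is the full slice over the image of the chart of the base. Hence
  every point of the slice near a given one comes from a point of the bundle.\<close>

lemma proj_chart_surj:
  assumes X: "complex_manifold X A" and c: "c \<in> A" and z: "base_part x \<in> snd c ` fst c" and a: "x $ Inr a = 1"
  shows "x \<in> snd (proj_chart X A c a) ` fst (proj_chart X A c a)"
proof -
  define p where "p = chart_inv c (base_part x)"
  have p: "p \<in> fst c" "snd c p = base_part x"
    unfolding p_def using chart_inv_in[OF z] chart_inv_right[OF z] by auto
  define v where "v = tvec_of_coords A c p (fibre_part x)"
  have v: "v \<in> tangent_space A p" unfolding v_def by (rule tvec_of_coords_tangent[OF X c p(1)])
  have vc: "v c = fibre_part x" unfolding v_def by (rule tvec_of_coords_chart[OF X c p(1)])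
  have va: "v c $ a = 1" unfolding vc using a by (simp add: fibre_part_def)
  then have vz: "v \<noteq> tzero" by (auto simp: tzero_def)
  have ptop: "p \<in> topspace X" using openin_subset[OF complex_manifold_chart(1)[OF X c]] p(1) by blast
  define Q where "Q = (p, range (\<lambda>k. tscale k v))"
  have "v = tscale 1 v" by (simp add: tscale_def)
  then have vQ: "v \<in> snd Q" unfolding Q_def by auto
  have "Q \<in> proj_tangent X A"
    unfolding Q_def proj_tangent_def using ptop v vz by blast
  moreover have "\<exists>v\<in>snd Q. v c $ a \<noteq> 0" using vQ va by (metis zero_neq_one)
  ultimately have Q: "Q \<in> fst (proj_chart X A c a)"
    using p(1) unfolding proj_chart_def by (simp add: Q_def)
  obtain w where w: "snd Q = range (\<lambda>k. tscale k w)" "w c $ a = 1"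
    "base_part (snd (proj_chart X A c a) Q) = snd c (fst Q)"
    "fibre_part (snd (proj_chart X A c a) Q) = w c"
    using proj_chart_coords[OF Q] by metis
  obtain k where k: "v = tscale k w" using vQ w(1) by blast
  then have "k = 1" using va w(2) by (simp add: tscale_def)
  with k have "w c = fibre_part x" using vc by (simp add: tscale_def)
  then have "snd (proj_chart X A c a) Q = x"
    using w(3,4) p(2) by (intro base_fibre_eqI) (simp_all add: Q_def)
  then show ?thesis using Q by blast
qed

text \<open>The right-hand side makes sense on an open set of the ambient coordinate space, not only on the
  slice; it is the extension that is differentiated.\<close>

lemma Y_fun_in_proj_chart:
  assumes X: "hermitian_manifold X A h" and Y: "hermitian_manifold Y B g" and f: "holomorphic_map X A Y B f"
    and c: "c \<in> A" and d: "d \<in> B" and Q: "Q \<in> fst (proj_chart X A c a)" and fd: "f (fst Q) \<in> fst d"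
    and x: "x = snd (proj_chart X A c a) Q"
  shows "Y_fun A h B g f Q = Y_local A h B g f c d (chart_inv c (base_part x)) (fibre_part x)"
proof -
  have X': "complex_manifold X A" using X unfolding hermitian_manifold_def by blast
  obtain v where v: "v \<in> tangent_space A (fst Q)" "v \<noteq> tzero" "snd Q = range (\<lambda>k. tscale k v)"
    "fst Q \<in> fst c" "base_part x = snd c (fst Q)" "fibre_part x = v c"
    using proj_chart_coords[OF Q] unfolding x by metis
  have "Y_fun A h B g f (fst Q, snd Q) = Y_local A h B g f c d (fst Q) (v c)"
    unfolding v(3) by (rule Y_fun_eq_Y_local[OF X Y f v(1,2) c v(4) d fd])
  then show ?thesis
    unfolding v(5,6) by (simp add: chart_inv_left[OF complex_manifold_chart(3)[OF X' c] v(4)])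
qed

section \<open>Derivatives along an affine slice\<close>

text \<open>A line in a direction other than \<open>b\<close> stays in the slice on which the coordinate \<open>b\<close> is constant.\<close>

lemma dir_deriv_slice_cong:
  fixes U :: "(complex ^ 'k::finite) set"
  assumes U: "open U" "y \<in> U" and b: "y $ b = e" "A \<noteq> b"
    and eq: "\<And>y. y \<in> U \<Longrightarrow> y $ b = e \<Longrightarrow> u y = v y"
  shows "dir_deriv u (axis A k) y = dir_deriv v (axis A k) y"
proof -
  have "open ((\<lambda>r::real. y + r *\<^sub>R axis A k) -` U)"
    by (intro open_vimage[OF U(1)] continuous_intros)
  moreover have "0 \<in> (\<lambda>r::real. y + r *\<^sub>R axis A k) -` U" using U(2) by simp
  moreover have "u (y + r *\<^sub>R axis A k) = v (y + r *\<^sub>R axis A k)"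
    if "r \<in> (\<lambda>r::real. y + r *\<^sub>R axis A k) -` U" for r
    using that b by (intro eq) (auto simp: axis_component)
  ultimately have "eventually (\<lambda>r::real. u (y + r *\<^sub>R axis A k) = v (y + r *\<^sub>R axis A k)) (nhds 0)"
    unfolding eventually_nhds by blast
  then show ?thesis
    unfolding dir_deriv_def by (intro vector_derivative_cong_eq) (auto elim: eventually_mono)
qed

lemma ddbar_slice_cong:
  fixes U :: "(complex ^ 'k::finite) set"
  assumes U: "open U" "x \<in> U" and b: "x $ b = e" "s \<noteq> b" "t \<noteq> b"
    and eq: "\<And>y. y \<in> U \<Longrightarrow> y $ b = e \<Longrightarrow> u y = v y"
  shows "ddbar u x s t = ddbar v x s t"
proof -
  have "wdbar t u y = wdbar t v y" if "y \<in> U" "y $ b = e" for y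
    unfolding wdbar_def by (simp only: dir_deriv_slice_cong[OF U(1) that b(3) eq])
  from dir_deriv_slice_cong[OF U b(1,2) this]
  show ?thesis unfolding ddbar_def wd_def[of s "wdbar t u"] wd_def[of s "wdbar t v"] by (simp only:)
qed

lemma form_ge_cong:
  assumes "\<And>s t. s \<in> I \<Longrightarrow> t \<in> I \<Longrightarrow> \<phi> s t = \<phi>' s t" "\<And>s t. s \<in> I \<Longrightarrow> t \<in> I \<Longrightarrow> \<psi> s t = \<psi>' s t"
    and ge: "form_ge I \<phi>' \<psi>'"
  shows "form_ge I \<phi> \<psi>"
proof -
  have sums: "(\<Sum>s\<in>I. \<Sum>t\<in>I. (\<phi> s t - \<psi> s t) * \<xi> s * cnj (\<xi> t)) =
      (\<Sum>s\<in>I. \<Sum>t\<in>I. (\<phi>' s t - \<psi>' s t) * \<xi> s * cnj (\<xi> t))" for \<xi>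
    by (intro sum.cong refl) (simp add: assms(1,2))
  have "real_form I \<alpha>" if \<alpha>': "real_form I \<alpha>'" and eq: "\<And>s t. s \<in> I \<Longrightarrow> t \<in> I \<Longrightarrow> \<alpha> s t = \<alpha>' s t" for \<alpha> \<alpha>'
    unfolding real_form_def
  proof (intro ballI)
    fix s t assume "s \<in> I" "t \<in> I"
    then show "\<alpha> t s = cnj (\<alpha> s t)"
      using \<alpha>' unfolding eq[OF \<open>s \<in> I\<close> \<open>t \<in> I\<close>] eq[OF \<open>t \<in> I\<close> \<open>s \<in> I\<close>] real_form_def by blast
  qed
  note real_form_cong = this
  show ?thesis
    unfolding form_ge_def
  proof (intro conjI allI)
    show "real_form I \<phi>" "real_form I \<psi>"
      using ge real_form_cong[of \<phi>' \<phi>, OF _ assms(1)] real_form_cong[of \<psi>' \<psi>, OF _ assms(2)]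
      unfolding form_ge_def by blast+
    show "0 \<le> Re (\<Sum>s\<in>I. \<Sum>t\<in>I. (\<phi> s t - \<psi> s t) * \<xi> s * cnj (\<xi> t))" for \<xi>
      unfolding sums using ge unfolding form_ge_def by blast
  qed
qed

section \<open>Functions of the base coordinates\<close>

lemma has_wirtinger_base_part:
  assumes u: "sep_holo S u" and x: "base_part x \<in> S"
  shows "has_wirtinger (\<lambda>x. u (base_part x)) s x (case s of Inl \<alpha> \<Rightarrow> wd \<alpha> u (base_part x) | Inr _ \<Rightarrow> 0) 0"
proof (cases s)
  case (Inl \<alpha>)
  have "base_part (x + axis (Inl \<alpha>) t) = base_part x + axis \<alpha> t" for t
    by (simp add: base_part_def vec_eq_iff axis_component)
  then show ?thesis
    using sep_holo_has_wirtinger[OF u x, of \<alpha>] unfolding has_wirtinger_def Inl by simp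
next
  case (Inr \<beta>)
  have "base_part (x + axis (Inr \<beta>) t) = base_part x" for t
    by (simp add: base_part_def vec_eq_iff axis_component)
  then show ?thesis
    unfolding has_wirtinger_def Inr by simp
qed

lemma continuous_base_part: "continuous_on T base_part"
  unfolding base_part_def[abs_def] by (intro continuous_intros)

lemma continuous_fibre_part: "continuous_on T fibre_part"
  unfolding fibre_part_def[abs_def] by (intro continuous_intros)

lemma sep_holo_base_part:
  assumes "sep_holo S u" "\<And>x. x \<in> T \<Longrightarrow> base_part x \<in> S"
  shows "sep_holo T (\<lambda>x. u (base_part x))"
proof (rule sep_holoI[OF _ has_wirtinger_base_part[OF assms(1)]])
  show "continuous_on T (\<lambda>x. u (base_part x))"
    by (rule continuous_on_compose2[OF sep_holo_continuous[OF assms(1)] continuous_base_part])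
       (use assms(2) in auto)
qed (rule assms(2))

section \<open>The flat metric on the complex numbers\<close>

lemma chart_inv_complex_chart: "chart_inv complex_chart w = w $ 1"
proof -
  have "inj (\<lambda>z::complex. (\<chi> i. z) :: complex ^ 1)" by (auto simp: inj_def vec_eq_iff)
  moreover have "w = (\<chi> i. w $ 1)" by (simp add: vec_eq_iff num1_eq1)
  ultimately show ?thesis
    unfolding chart_inv_def complex_chart_def by (metis fst_conv snd_conv inv_f_f)
qed

lemma second_countable_euclidean: "second_countable (euclidean :: 'a::second_countable_topology topology)"
proof -
  obtain \<B> :: "'a set set" where "countable \<B>" "topological_basis \<B>"
    using ex_countable_basis by blast
  then show ?thesis
    unfolding second_countable_def open_openin[symmetric]
    by (metis topological_basisE topological_basis_open)
qed

text \<open>The atlas has a single chart, and its coordinate change is the identity.\<close>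

lemma complex_manifold_complex: "complex_manifold euclidean {complex_chart}"
proof -
  have eq: "(\<chi> i. w $ 1) = w" for w :: "complex ^ 1" by (simp add: vec_eq_iff num1_eq1)
  have im: "snd complex_chart ` fst complex_chart = UNIV"
  proof -
    have "w \<in> range (\<lambda>z. \<chi> i. z)" for w :: "complex ^ 1" using eq[of w] by (metis rangeI)
    then show ?thesis unfolding complex_chart_def by auto
  qed
  have "homeomorphic_maps euclidean euclidean (snd complex_chart) (\<lambda>w. w $ 1)"
    unfolding homeomorphic_maps_def complex_chart_def by (auto simp: eq intro!: continuous_intros)
  then have hom: "homeomorphic_map euclidean euclidean (snd complex_chart)"
    unfolding homeomorphic_map_maps by blast
  have "snd complex_chart \<circ> chart_inv complex_chart = (\<lambda>w. w)"
    unfolding fun_eq_iff o_apply chart_inv_complex_chart by (simp add: complex_chart_def eq)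
  moreover have "holo_on S (\<lambda>w. w)" for S :: "(complex ^ 1) set"
    unfolding holo_on_def by (auto intro!: exI[of _ "\<lambda>w. w"])
  ultimately have "holo_on S (snd complex_chart \<circ> chart_inv complex_chart)" for S by simp
  moreover have "fst complex_chart = UNIV" by (simp add: complex_chart_def)
  ultimately show ?thesis
    unfolding complex_manifold_def using hom im second_countable_euclidean by simp
qed

lemma metric_coeff_flat: "metric_coeff {complex_chart} flat_metric complex_chart p i j = 1"
proof -
  have "coord_frame {complex_chart} complex_chart p k complex_chart $ 1 = 1" for k
    unfolding coord_frame_eq using tvec_of_coords_chart[OF complex_manifold_complex, of complex_chart p]
    by (simp add: complex_chart_def axis_def num1_eq1)
  then show ?thesis unfolding metric_coeff_def flat_metric_def by simp
qed

lemma smooth_on_const: "smooth_on S (\<lambda>_. c)"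
proof -
  have "Ck_on k S (\<lambda>_. c)" for k c
    by (induction k arbitrary: c) (simp_all add: frechet_derivative_const)
  then show ?thesis unfolding smooth_on_def by blast
qed

lemma hermitian_manifold_complex: "hermitian_manifold euclidean {complex_chart} flat_metric"
proof -
  have pos: "0 < Re (flat_metric p v v)" if v: "v \<in> tangent_space {complex_chart} p" "v \<noteq> tzero" for p v
  proof -
    have "v c = 0" if "c \<noteq> complex_chart" for c
      using v(1) that unfolding tangent_space_def by blast
    with v(2) have "v complex_chart \<noteq> 0" unfolding tzero_def by metis
    then have "v complex_chart $ 1 \<noteq> 0" by (simp add: vec_eq_iff num1_eq1)
    then show ?thesis unfolding flat_metric_def complex_mult_cnj
      by (simp add: sum_power2_gt_zero_iff complex_eq_iff)
  qed
  have "hermitian_metric euclidean {complex_chart} flat_metric"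
    unfolding hermitian_metric_def
  proof (intro conjI ballI allI impI)
    fix c \<alpha> \<beta> assume "c \<in> {complex_chart}"
    then show "smooth_on (snd c ` fst c) (\<lambda>z. metric_coeff {complex_chart} flat_metric c (chart_inv c z) \<alpha> \<beta>)"
      by (simp add: metric_coeff_flat smooth_on_const)
  qed (use pos in \<open>auto simp: flat_metric_def tadd_def tscale_def algebra_simps\<close>)
  then show ?thesis unfolding hermitian_manifold_def using complex_manifold_complex by blast
qed

text \<open>The coefficients of the metric are constant.\<close>

lemma curv_form_flat: "curv_form X A h {complex_chart} flat_metric f c complex_chart a Q s t = 0"
proof -
  have "chern_curv {complex_chart} flat_metric complex_chart y k l i j = 0" for y k l i j
  proof -
    have "wd A (\<lambda>_. c) = (\<lambda>_. 0)" "wdbar A (\<lambda>_. c) = (\<lambda>_. 0)" for A :: 1 and c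
      using has_wirtinger_wd[OF has_wirtinger_const] has_wirtinger_wdbar[OF has_wirtinger_const] by blast+
    then show ?thesis unfolding chern_curv_def Let_def metric_coeff_flat by simp
  qed
  then show ?thesis unfolding curv_form_def Let_def by (simp split: sum.split)
qed

section \<open>The inequality on the projectivised tangent bundle\<close>

text \<open>In charts, \<open>N\<close> is the squared norm of \<open>V\<^sup>i = \<Sum>\<alpha>. f\<^sup>i\<^sub>\<alpha> W\<^sup>\<alpha>\<close> along \<open>f\<close> composed with the projection to the
  base, and \<open>H\<close> that of \<open>W\<close> along the projection. Both live on the open set \<open>U\<close> of all pairs of a base
  point and a nonzero vector.\<close>

lemma proj_bundle_inequality:
  fixes A :: "('a, 'm::finite) chart set" and B :: "('b, 'n::finite) chart set"
  assumes X: "hermitian_manifold X A h" and Y: "hermitian_manifold Y B g" and f: "holomorphic_map X A Y B f"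
    and c: "c \<in> A" and d: "d \<in> B" and Q: "Q \<in> fst (proj_chart X A c a)" and fQ: "f (fst Q) \<in> fst d"
  shows "form_ge (proj_coords a) (ddbar_Y X A h B g f c a Q)
    (\<lambda>s t. ddbar_log_Hinv X A h c a Q s t * Y_fun A h B g f Q - curv_form X A h B g f c d a Q s t)"
proof -
  have X': "complex_manifold X A" "hermitian_metric X A h" and Y': "complex_manifold Y B" "hermitian_metric Y B g"
    using X Y unfolding hermitian_manifold_def by blast+
  note invc = chart_inv_left[OF complex_manifold_chart(3)[OF X'(1) c]]
    and invd = chart_inv_left[OF complex_manifold_chart(3)[OF Y'(1) d]]
  define S where "S = snd c ` (fst c \<inter> f -` fst d)"
  have S: "open S" unfolding S_def by (rule holomorphic_map_domain[OF X'(1) Y'(1) f c d])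
  have Sc: "chart_inv c z \<in> fst c" "f (chart_inv c z) \<in> fst d" "snd c (chart_inv c z) = z" if "z \<in> S" for z
    using that invc unfolding S_def by auto
  define U where "U = {x :: complex ^ ('m + 'm). base_part x \<in> S \<and> fibre_part x \<noteq> 0}"
  have U: "open U"
  proof -
    have "U = base_part -` S \<inter> fibre_part -` (- {0})" unfolding U_def by auto
    moreover have "open (base_part -` S)" "open (fibre_part -` (- {0 :: complex ^ 'm}))"
      by (rule open_vimage[OF S continuous_base_part], rule open_vimage[OF _ continuous_fibre_part]) auto
    ultimately show ?thesis by auto
  qed
  define G where "G i j \<eta> = metric_coeff B g d (chart_inv d \<eta>) i j" for i j \<eta>
  define H where "H \<alpha> \<beta> z = metric_coeff A h c (chart_inv c z) \<alpha> \<beta>" for \<alpha> \<beta> z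
  define F0 where "F0 i z = snd d (f (chart_inv c z)) $ i" for i z
  define F where "F i x = F0 i (base_part x)" for i and x :: "complex ^ ('m + 'm)"
  define V where "V i x = (\<Sum>\<alpha>\<in>UNIV. wd \<alpha> (F0 i) (base_part x) * x $ Inr \<alpha>)" for i and x :: "complex ^ ('m + 'm)"
  have F_point: "(\<chi> i. F i y) = snd d (f (chart_inv c (base_part y)))" for y
    by (simp add: F_def F0_def vec_eq_iff)
  have F0: "sep_holo S (F0 i)" for i
  proof -
    have "holo_on S (snd d \<circ> f \<circ> chart_inv c)"
      using f c d unfolding holomorphic_map_def S_def by blast
    from holo_on_sep_holo[OF this, of i] show ?thesis unfolding F0_def[abs_def] by simp
  qed
  have US: "base_part y \<in> S" if "y \<in> U" for y using that unfolding U_def by blast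
  have N: "holomorphic_section_norm U (snd d ` fst d) G F V"
  proof
    show "open U" by (rule U)
    show "open (snd d ` fst d)" by (rule complex_manifold_chart(2)[OF Y'(1) d])
    show "smooth_on (snd d ` fst d) (G i j)" for i j
      using Y'(2) d unfolding hermitian_metric_def G_def[abs_def] by blast
    show "cnj (G i j y) = G j i y" if "y \<in> snd d ` fst d" for y i j
      unfolding G_def by (rule metric_coeff_cnj[OF Y' d chart_inv_in[OF that]])
    show "sep_holo U (F i)" for i
      unfolding F_def[abs_def] by (rule sep_holo_base_part[OF F0 US])
    show "sep_holo U (V i)" for i
      unfolding V_def[abs_def]
      by (intro sep_holo_sum sep_holo_mult sep_holo_component sep_holo_base_part[OF sep_holo_wd[OF S F0] US])
    show "(\<chi> i. F i x) \<in> snd d ` fst d" if "x \<in> U" for x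
      unfolding F_point using Sc(2)[OF US[OF that]] by blast
  qed
  have HM: "holomorphic_section_norm U (snd c ` fst c) H (\<lambda>\<alpha> x. x $ Inl \<alpha>) (\<lambda>\<alpha> x. x $ Inr \<alpha>)"
  proof
    show "open U" by (rule U)
    show "open (snd c ` fst c)" by (rule complex_manifold_chart(2)[OF X'(1) c])
    show "smooth_on (snd c ` fst c) (H i j)" for i j
      using X'(2) c unfolding hermitian_metric_def H_def[abs_def] by blast
    show "cnj (H i j y) = H j i y" if "y \<in> snd c ` fst c" for y i j
      unfolding H_def by (rule metric_coeff_cnj[OF X' c chart_inv_in[OF that]])
    show "(\<chi> i. x $ Inl i) \<in> snd c ` fst c" if "x \<in> U" for x
      using US[OF that] unfolding S_def base_part_def by auto
  qed (rule sep_holo_component)+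
  interpret N: holomorphic_section_norm U "snd d ` fst d" G F V by (rule N)
  interpret H: holomorphic_section_norm U "snd c ` fst c" H "\<lambda>\<alpha> x. x $ Inl \<alpha>" "\<lambda>\<alpha> x. x $ Inr \<alpha>" by (rule HM)
  have HP: "H.P y = H_local A h c (chart_inv c (base_part y)) (fibre_part y)" for y
    by (simp add: H.P_def H_local_def H_def base_part_def fibre_part_def mult.assoc)
  have V: "V i y = (map_jac c d f (chart_inv c (base_part y)) *v fibre_part y) $ i" if "y \<in> U" for i y
    unfolding V_def map_jac_def matrix_vector_mult_def Sc(3)[OF US[OF that]]
    by (simp add: F0_def[abs_def] fibre_part_def)
  have NP: "N.P y / H.P y = Y_local A h B g f c d (chart_inv c (base_part y)) (fibre_part y)" if y: "y \<in> U" for y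
    unfolding Y_local_sesq HP[symmetric] N.P_def F_point V[OF y] G_def invd[OF Sc(2)[OF US[OF y]]]
    by (simp add: sesq_def mult.assoc)
  have H_pos: "0 < Re (H.P y)" if y: "y \<in> U" for y
  proof -
    have "(\<lambda>i. fibre_part y $ i) \<noteq> (\<lambda>_. 0)"
      using y unfolding U_def by (auto simp: vec_eq_iff fun_eq_iff)
    from metric_coeff_pos[OF X' c Sc(1)[OF US[OF y]] this] show ?thesis
      unfolding HP H_local_sesq .
  qed
  define x where "x = snd (proj_chart X A c a) Q"
  obtain v where v: "fst Q \<in> fst c" "v c $ a = 1" "base_part x = snd c (fst Q)" "fibre_part x = v c"
    using proj_chart_coords[OF Q] unfolding x_def by metis
  have p: "chart_inv c (base_part x) = fst Q" unfolding v(3) by (rule invc[OF v(1)])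
  have xa: "x $ Inr a = 1" using v(2) unfolding v(4)[symmetric] by (simp add: fibre_part_def)
  have xU: "x \<in> U"
    unfolding U_def S_def using v fQ by auto
  have Fx: "(\<chi> i. F i x) = snd d (f (fst Q))" unfolding F_point p ..
  have R: "chern_curv B g d (f (fst Q)) k l i j = - wd k (wdbar l (G i j)) (\<chi> i. F i x)
      + (\<Sum>p\<in>UNIV. \<Sum>q\<in>UNIV. metric_inv B g d (f (fst Q)) p q * wd k (G i q) (\<chi> i. F i x) * wdbar l (G p j) (\<chi> i. F i x))"
    for k l i j
    unfolding chern_curv_def Let_def Fx G_def[abs_def] ..
  have Gx: "G i j (\<chi> i. F i x) = metric_coeff B g d (f (fst Q)) i j" for i j
    unfolding Fx G_def invd[OF fQ] ..
  have Ginv: "(\<Sum>i\<in>UNIV. G i j (\<chi> i. F i x) * metric_inv B g d (f (fst Q)) i q) = (if q = j then 1 else 0)" for j q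
    unfolding Gx by (rule metric_inv_inverse[OF Y' d fQ])
  have psd: "0 \<le> Re (sesq (\<lambda>i j. G i j (\<chi> i. F i x)) b b)" for b
  proof (cases "b = (\<lambda>_. 0)")
    case False
    then show ?thesis unfolding Gx using metric_coeff_pos[OF Y' d fQ False] by simp
  qed (simp add: sesq_zero)
  note ineq = section_norm_quotient_inequality[OF N HM xU H_pos Ginv psd R, of "proj_coords a"]
  show ?thesis
  proof (rule form_ge_cong[OF _ _ ineq])
    fix s t assume s: "s \<in> proj_coords a" and t: "t \<in> proj_coords a"
    have "ddbar (Y_fun A h B g f \<circ> chart_inv (proj_chart X A c a)) x s t = ddbar (\<lambda>y. N.P y / H.P y) x s t"
    proof (rule ddbar_slice_cong[OF U xU xa])
      show "s \<noteq> Inr a" "t \<noteq> Inr a" using s t unfolding proj_coords_def by auto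
      fix y assume y: "y \<in> U" "y $ Inr a = 1"
      let ?Q = "chart_inv (proj_chart X A c a) y"
      have "base_part y \<in> snd c ` fst c" using US[OF y(1)] unfolding S_def by blast
      then have im: "y \<in> snd (proj_chart X A c a) ` fst (proj_chart X A c a)"
        by (rule proj_chart_surj[OF X'(1) c _ y(2)])
      have Q': "?Q \<in> fst (proj_chart X A c a)" "y = snd (proj_chart X A c a) ?Q"
        using chart_inv_in[OF im] chart_inv_right[OF im] by simp_all
      obtain w where w: "fst ?Q \<in> fst c" "base_part y = snd c (fst ?Q)"
        using proj_chart_coords[OF Q'(1)] Q'(2) by metis
      have "fst ?Q = chart_inv c (base_part y)" unfolding w(2) by (rule invc[OF w(1), symmetric])
      then have "f (fst ?Q) \<in> fst d" using Sc(2)[OF US[OF y(1)]] by simp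
      from Y_fun_in_proj_chart[OF X Y f c d Q'(1) this Q'(2)]
      show "(Y_fun A h B g f \<circ> chart_inv (proj_chart X A c a)) y = N.P y / H.P y"
        unfolding NP[OF y(1)] by simp
    qed
    then show "ddbar_Y X A h B g f c a Q s t = ddbar (\<lambda>y. N.P y / H.P y) x s t"
      unfolding ddbar_Y_def x_def .
    have "ddbar_log_Hinv X A h c a Q s t = ddbar (\<lambda>y. Ln (inverse (H.P y))) x s t"
      unfolding ddbar_log_Hinv_def HP x_def ..
    moreover have "Y_fun A h B g f Q = N.P x / H.P x"
      unfolding NP[OF xU] by (rule Y_fun_in_proj_chart[OF X Y f c d Q fQ x_def])
    moreover have "curv_form X A h B g f c d a Q s t = (\<Sum>k\<in>UNIV. \<Sum>l\<in>UNIV. \<Sum>i\<in>UNIV. \<Sum>j\<in>UNIV.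
        chern_curv B g d (f (fst Q)) k l i j * wd s (F k) x * cnj (wd t (F l) x) * V i x * cnj (V j x)) / H.P x"
    proof -
      let ?J = "map_jac c d f (fst Q)"
      \<comment> \<open>The map is constant in the fibre directions, which leaves only base components in the curvature term.\<close>
      have wdF: "wd s (F k) x = (case s of Inl \<alpha> \<Rightarrow> ?J $ k $ \<alpha> | Inr _ \<Rightarrow> 0)" for s k
      proof -
        have "wd s (F k) x = (case s of Inl \<alpha> \<Rightarrow> wd \<alpha> (F0 k) (base_part x) | Inr _ \<Rightarrow> 0)"
          unfolding F_def[abs_def] by (rule has_wirtinger_wd[OF has_wirtinger_base_part[OF F0 US[OF xU]]])
        then show ?thesis
          unfolding map_jac_def v(3) F0_def[abs_def] by (simp split: sum.split)
      qed
      have Vx: "V i x = (\<Sum>\<mu>\<in>UNIV. ?J $ i $ \<mu> * fibre_part x $ \<mu>)" for i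
        unfolding V[OF xU] p matrix_vector_mult_def by simp
      have VV: "V i x * cnj (V j x) = (\<Sum>\<mu>\<in>UNIV. \<Sum>\<nu>\<in>UNIV. (?J $ i $ \<mu> * fibre_part x $ \<mu>) *
          (cnj (?J $ j $ \<nu>) * cnj (fibre_part x $ \<nu>)))" for i j
        unfolding Vx by (simp add: sum_product)
      show ?thesis
      proof (cases "\<exists>\<alpha> \<beta>. s = Inl \<alpha> \<and> t = Inl \<beta>")
          case True
          then obtain \<alpha> \<beta> where st: "s = Inl \<alpha>" "t = Inl \<beta>" by blast
          have "curv_form X A h B g f c d a Q s t =
            (\<Sum>k\<in>UNIV. \<Sum>l\<in>UNIV. \<Sum>i\<in>UNIV. \<Sum>j\<in>UNIV. \<Sum>\<mu>\<in>UNIV. \<Sum>\<nu>\<in>UNIV.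
              chern_curv B g d (f (fst Q)) k l i j * ?J $ k $ \<alpha> * cnj (?J $ l $ \<beta>)
                * ?J $ i $ \<mu> * cnj (?J $ j $ \<nu>) * fibre_part x $ \<mu> * cnj (fibre_part x $ \<nu>)) / H.P x"
            unfolding curv_form_def st HP p x_def[symmetric] by (simp add: Let_def)
          also have "\<dots> = (\<Sum>k\<in>UNIV. \<Sum>l\<in>UNIV. \<Sum>i\<in>UNIV. \<Sum>j\<in>UNIV.
              chern_curv B g d (f (fst Q)) k l i j * wd s (F k) x * cnj (wd t (F l) x) * (V i x * cnj (V j x))) / H.P x"
            unfolding VV wdF st by (simp add: sum_distrib_left mult_ac)
          finally show ?thesis by (simp only: mult.assoc)
        next
          case False
          then have "wd s (F k) x * cnj (wd t (F l) x) = 0" for k l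
            unfolding wdF by (auto split: sum.split)
          then have "chern_curv B g d (f (fst Q)) k l i j * wd s (F k) x * cnj (wd t (F l) x) = 0" for k l i j
            by (simp only: mult.assoc mult_zero_right)
          moreover have "curv_form X A h B g f c d a Q s t = 0"
            using False unfolding curv_form_def by (auto split: sum.split)
          ultimately show ?thesis
            by (simp only: mult_zero_left sum.neutral_const div_0)
      qed
    qed
    ultimately show "ddbar_log_Hinv X A h c a Q s t * Y_fun A h B g f Q - curv_form X A h B g f c d a Q s t =
      ddbar (\<lambda>y. Ln (inverse (H.P y))) x s t * (N.P x / H.P x) - (\<Sum>k\<in>UNIV. \<Sum>l\<in>UNIV. \<Sum>i\<in>UNIV. \<Sum>j\<in>UNIV.
        chern_curv B g d (f (fst Q)) k l i j * wd s (F k) x * cnj (wd t (F l) x) * V i x * cnj (V j x)) / H.P x"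
      by (simp only:)
  qed
qed

theorem theorem1p1:
  fixes X :: "'a topology" and A :: "('a, 'm::finite) chart set" and h :: "('a, 'm) metric"
  assumes M: "hermitian_manifold X A h"
  shows "(\<forall>(Y :: 'b topology) (B :: ('b, 'n::finite) chart set) (g :: ('b, 'n) metric) (f :: 'a \<Rightarrow> 'b).
            hermitian_manifold Y B g \<and> holomorphic_map X A Y B f \<longrightarrow>
            (\<forall>c\<in>A. \<forall>a. \<forall>d\<in>B. \<forall>Q \<in> fst (proj_chart X A c a). f (fst Q) \<in> fst d \<longrightarrow>
               form_ge (proj_coords a)
                 (ddbar_Y X A h B g f c a Q)
                 (\<lambda>s t. ddbar_log_Hinv X A h c a Q s t * Y_fun A h B g f Q
                        - curv_form X A h B g f c d a Q s t)))
       \<and> (\<forall>f :: 'a \<Rightarrow> complex.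
            holomorphic_map X A euclidean {complex_chart} f \<longrightarrow>
            (\<forall>c\<in>A. \<forall>a. \<forall>Q \<in> fst (proj_chart X A c a).
               form_ge (proj_coords a)
                 (ddbar_Y X A h {complex_chart} flat_metric f c a Q)
                 (\<lambda>s t. ddbar_log_Hinv X A h c a Q s t * Y_fun A h {complex_chart} flat_metric f Q)))"
proof (intro conjI allI impI ballI)
  fix Y :: "'b topology" and B :: "('b, 'n) chart set" and g f c a d Q
  assume "hermitian_manifold Y B g \<and> holomorphic_map X A Y B f" "c \<in> A" "d \<in> B"
    "Q \<in> fst (proj_chart X A c a)" "f (fst Q) \<in> fst d"
  then show "form_ge (proj_coords a) (ddbar_Y X A h B g f c a Q)
     (\<lambda>s t. ddbar_log_Hinv X A h c a Q s t * Y_fun A h B g f Q - curv_form X A h B g f c d a Q s t)"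
    using proj_bundle_inequality[OF M] by blast
next
  fix f :: "'a \<Rightarrow> complex" and c a Q
  assume f: "holomorphic_map X A euclidean {complex_chart} f" and c: "c \<in> A"
    and Q: "Q \<in> fst (proj_chart X A c a)"
  have "f (fst Q) \<in> fst complex_chart" by (simp add: complex_chart_def)
  from proj_bundle_inequality[OF M hermitian_manifold_complex f c insertI1 Q this]
  show "form_ge (proj_coords a) (ddbar_Y X A h {complex_chart} flat_metric f c a Q)
     (\<lambda>s t. ddbar_log_Hinv X A h c a Q s t * Y_fun A h {complex_chart} flat_metric f Q)"
    unfolding curv_form_flat by simp
qed

end
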